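(* Let $\alpha=(A,(A_i)_{i\in I_\alpha})$ and $\beta=(B,(B_i)_{i\in I_\beta})$ be two coset incidence systems (with finite type sets) and suppose that $B$ acts on a finite set $\Omega$ in such a way that this action satisfies (IPO). Suppose also that $A$ and $B$ act flag-transitively on $\alpha$ and $\beta$ respectively. Then: (a) the group $A\wr_\Omega B$ acts flag-transitively on $\alpha\wr_\Omega\beta$; (b) the coset incidence system $\alpha\wr_\Omega\beta$ is a geometry; (c) $\alpha\wr_\Omega\beta$ is residually connected if $\alpha$ and $\beta$ are residually connected; (d) $\alpha\wr_\Omega\beta$ is firm if both $\alpha$ and $\beta$ are firm; and $\alpha\wr_\Omega\beta$ is thin if both $\alpha$ and $\beta$ are thin (thin coset geometries being taken to have trivial Borel subgroup, i.e. $A_{I_\alpha}=1$ and $B_{I_\beta}=1$ in the thin case).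
   Context: All type sets are finite. An incidence system over a type set $I$ consists of a set $X$ of elements, a type map $t:X\to I$, and a symmetric reflexive incidence relation on $X$ such that distinct incident elements have distinct types. A flag is a set of pairwise incident elements; its type is the set of types of its elements; a chamber is a flag of type $I$. The system is a geometry if all maximal flags are chambers. The residue of a flag $F$ is the incidence system formed by the elements incident to all elements of $F$ but not in $F$; for a geometry its rank is $|I|-|F|$. A geometry is residually connected if every residue (including that of the empty flag) of rank at least two has a connected incidence graph. It is firm (resp. thin) if each residue of a flag of corank one contains at least two (resp. exactly two) elements. A coset incidence system $(G,(G_i)_{i\in I})$ consists of a group $G$ and subgroups $G_i\le G$; it is the incidence system over $I$ whose elements of type $i$ are the left cosets $gG_i$, with $gG_i$ incident to $kG_j$ iff $gG_i\cap kG_j\neq\emptyset$. For $J\subseteq I$ put $G_J=\bigcap_{j\in J}G_j$, with $G_\emptyset=G$; $G_I$ is the Borel subgroup. $G$ acts by left multiplication, and is flag-transitive if, for every $J\subseteq I$, it is transitive on the flags of type $J$. (IPO) for the action of $B$ on $\Omega$: for each orbit $O$ of $B$ on $\Omega$ there is a point $\omega_O\in O$ such that for all $M,N\subseteq I_\beta$, $(B_{I_\beta\setminus M}\,\omega_O)\cap(B_{I_\beta\setminus N}\,\omega_O)=B_{I_\beta\setminus(M\cap N)}\,\omega_O$. Product and wreath product: $\overline A=\prod_{\omega\in\Omega}A$, with $B$ acting by permuting coordinates, $b\cdot({}^\omega a)_{\omega}=({}^{b^{-1}\omega}a)_\omega$, and $A\wr_\Omega B=\overline A\rtimes B$. The product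 coset incidence system $\overline\alpha=\prod_{\omega\in\Omega}\alpha$ has group $\overline A$ and type set $I_{\overline\alpha}=I_\alpha\times\Omega$ (a disjoint union of copies of $I_\alpha$ indexed by $\Omega$), where $\overline A_{(j,\lambda)}$ is the subgroup of $\overline A$ of elements whose $\lambda$-coordinate lies in $A_j$. $B$ acts on $I_{\overline\alpha}$ by $b\cdot(j,\lambda)=(j,b\lambda)$. Let $K$ be the set of $B$-orbits on $I_{\overline\alpha}$. For each $L\in K$ choose a representative $F_L\in L$ such that, with ${}^LO_M$ denoting the orbit of $F_L$ under $B_{I_\beta\setminus M}$, one has ${}^LO_M\cap{}^LO_N={}^LO_{M\cap N}$ for all $M,N\subseteq I_\beta$ (possible by (IPO) on $\Omega$). For $i\in I_\beta$ let ${}^LO^i$ be the orbit of $F_L$ under $B_i$. Then $\alpha\wr_\Omega\beta$ is the coset incidence system $(G,(G_i)_{i\in I})$ over $I=K\sqcup I_\beta$ with $G=A\wr_\Omega B$, $G_i=\overline A_{\bigcup_{L\in K}(L\setminus{}^LO^i)}\rtimes B_i$ if $i\in I_\beta$, and $G_i=\overline A_i\rtimes B$ if $i\in K$ (where $\overline A_S=\bigcap_{s\in S}\overline A_s$ for $S\subseteq I_{\overline\alpha}$). It depends on the choice of representatives, and the theorem is for any such choice. *)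

theory Defs
  imports "HOL-Algebra.Group_Action" "HOL-Algebra.Left_Coset" "HOL-Algebra.Product_Groups"
begin

section \<open>Incidence systems\<close>

record ('x, 't) incidence_system =
  elems :: "'x set"
  types :: "'t set"
  type_of :: "'x \<Rightarrow> 't"
  inc :: "'x \<Rightarrow> 'x \<Rightarrow> bool"

definition is_incidence_system :: "('x, 't) incidence_system \<Rightarrow> bool" where
  "is_incidence_system S \<longleftrightarrow>
     finite (types S) \<and> type_of S \<in> elems S \<rightarrow> types S \<and>
     (\<forall>x\<in>elems S. inc S x x) \<and>
     (\<forall>x\<in>elems S. \<forall>y\<in>elems S. inc S x y \<longrightarrow> inc S y x) \<and>
     (\<forall>x\<in>elems S. \<forall>y\<in>elems S. inc S x y \<and> x \<noteq> y \<longrightarrow> type_of S x \<noteq> type_of S y)"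

definition flag :: "('x, 't) incidence_system \<Rightarrow> 'x set \<Rightarrow> bool" where
  "flag S F \<longleftrightarrow> F \<subseteq> elems S \<and> (\<forall>x\<in>F. \<forall>y\<in>F. inc S x y)"

definition flag_type :: "('x, 't) incidence_system \<Rightarrow> 'x set \<Rightarrow> 't set" where
  "flag_type S F = type_of S ` F"

definition chamber :: "('x, 't) incidence_system \<Rightarrow> 'x set \<Rightarrow> bool" where
  "chamber S F \<longleftrightarrow> flag S F \<and> flag_type S F = types S"

definition maximal_flag :: "('x, 't) incidence_system \<Rightarrow> 'x set \<Rightarrow> bool" where
  "maximal_flag S F \<longleftrightarrow> flag S F \<and> (\<forall>F'. flag S F' \<and> F \<subseteq> F' \<longrightarrow> F' = F)"

definition geometry :: "('x, 't) incidence_system \<Rightarrow> bool" where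
  "geometry S \<longleftrightarrow> is_incidence_system S \<and> (\<forall>F. maximal_flag S F \<longrightarrow> chamber S F)"

definition residue ::
    "('x, 't) incidence_system \<Rightarrow> 'x set \<Rightarrow> ('x, 't) incidence_system" where
  "residue S F =
     \<lparr>elems = {x \<in> elems S. \<forall>y\<in>F. inc S x y} - F,
      types = types S - flag_type S F, type_of = type_of S, inc = inc S\<rparr>"

text \<open>Type sets are finite and the elements of a flag have distinct types, so the truncated
  subtraction below is the rank of the residue of \<open>F\<close>.\<close>

definition corank :: "('x, 't) incidence_system \<Rightarrow> 'x set \<Rightarrow> nat" where
  "corank S F = card (types S) - card F"

definition connected_incidence_graph :: "('x, 't) incidence_system \<Rightarrow> bool" where
  "connected_incidence_graph S \<longleftrightarrow>
     (\<forall>x\<in>elems S. \<forall>y\<in>elems S.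
        (x, y) \<in> {(u, v). u \<in> elems S \<and> v \<in> elems S \<and> inc S u v}\<^sup>*)"

definition residually_connected :: "('x, 't) incidence_system \<Rightarrow> bool" where
  "residually_connected S \<longleftrightarrow> geometry S \<and>
     (\<forall>F. flag S F \<and> 2 \<le> corank S F \<longrightarrow> connected_incidence_graph (residue S F))"

text \<open>Residues may be infinite, so firmness cannot be stated as \<open>2 \<le> card\<close>: the cardinality
  of an infinite set is \<open>0\<close> in HOL.\<close>

definition firm :: "('x, 't) incidence_system \<Rightarrow> bool" where
  "firm S \<longleftrightarrow> geometry S \<and>
     (\<forall>F. flag S F \<and> corank S F = 1 \<longrightarrow>
        (\<exists>x\<in>elems (residue S F). \<exists>y\<in>elems (residue S F). x \<noteq> y))"

definition thin :: "('x, 't) incidence_system \<Rightarrow> bool" where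
  "thin S \<longleftrightarrow> geometry S \<and>
     (\<forall>F. flag S F \<and> corank S F = 1 \<longrightarrow> card (elems (residue S F)) = 2)"


section \<open>Coset incidence systems\<close>

record ('g, 't) coset_system =
  cgroup :: "'g monoid"
  ctypes :: "'t set"
  csub :: "'t \<Rightarrow> 'g set"

definition is_coset_system :: "('g, 't) coset_system \<Rightarrow> bool" where
  "is_coset_system C \<longleftrightarrow>
     group (cgroup C) \<and> finite (ctypes C) \<and> (\<forall>i\<in>ctypes C. subgroup (csub C i) (cgroup C))"

text \<open>Elements are pairs of a type and a coset, since the subgroups of distinct types may
  coincide.\<close>

definition coset_incidence :: "('g, 't) coset_system \<Rightarrow> ('t \<times> 'g set, 't) incidence_system" where
  "coset_incidence C =
     \<lparr>elems = (SIGMA i : ctypes C. lcosets\<^bsub>cgroup C\<^esub> (csub C i)),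
      types = ctypes C, type_of = fst, inc = (\<lambda>x y. snd x \<inter> snd y \<noteq> {})\<rparr>"

text \<open>\<open>parabolic C J\<close> is \<open>G\<^sub>J\<close>, with \<open>G\<^sub>\<emptyset> = G\<close>.\<close>

definition parabolic :: "('g, 't) coset_system \<Rightarrow> 't set \<Rightarrow> 'g set" where
  "parabolic C J = carrier (cgroup C) \<inter> (\<Inter>j\<in>J. csub C j)"

definition borel :: "('g, 't) coset_system \<Rightarrow> 'g set" where
  "borel C = parabolic C (ctypes C)"

definition left_mult :: "('g, 't) coset_system \<Rightarrow> 'g \<Rightarrow> 't \<times> 'g set \<Rightarrow> 't \<times> 'g set" where
  "left_mult C g x = (fst x, g <#\<^bsub>cgroup C\<^esub> snd x)"

definition flag_transitive :: "('g, 't) coset_system \<Rightarrow> bool" where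
  "flag_transitive C \<longleftrightarrow>
     (\<forall>J\<subseteq>ctypes C. \<forall>F F'.
        flag (coset_incidence C) F \<and> flag_type (coset_incidence C) F = J \<and>
        flag (coset_incidence C) F' \<and> flag_type (coset_incidence C) F' = J \<longrightarrow>
        (\<exists>g\<in>carrier (cgroup C). left_mult C g ` F = F'))"

text \<open>By convention a thin coset geometry has a trivial Borel subgroup.\<close>

definition thin_coset_geometry :: "('g, 't) coset_system \<Rightarrow> bool" where
  "thin_coset_geometry C \<longleftrightarrow> thin (coset_incidence C) \<and> borel C = {\<one>\<^bsub>cgroup C\<^esub>}"


section \<open>The intersection property on orbits\<close>

definition sub_orbit :: "('b, 'm) monoid_scheme \<Rightarrow> 'b set \<Rightarrow> ('b \<Rightarrow> 'w \<Rightarrow> 'w) \<Rightarrow> 'w \<Rightarrow> 'w set" where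
  "sub_orbit B H \<phi> x = orbit (B\<lparr>carrier := H\<rparr>) \<phi> x"

text \<open>Stated for a single point, since the same condition is imposed on points of \<open>\<Omega>\<close> in (IPO) and on
  representatives of orbits of types in the wreath product.\<close>

definition IPO_point :: "('b, 'j) coset_system \<Rightarrow> ('b \<Rightarrow> 'w \<Rightarrow> 'w) \<Rightarrow> 'w \<Rightarrow> bool" where
  "IPO_point \<beta> \<phi> x \<longleftrightarrow>
     (\<forall>M N. M \<subseteq> ctypes \<beta> \<and> N \<subseteq> ctypes \<beta> \<longrightarrow>
        sub_orbit (cgroup \<beta>) (parabolic \<beta> (ctypes \<beta> - M)) \<phi> x \<inter>
        sub_orbit (cgroup \<beta>) (parabolic \<beta> (ctypes \<beta> - N)) \<phi> x =
        sub_orbit (cgroup \<beta>) (parabolic \<beta> (ctypes \<beta> - M \<inter> N)) \<phi> x)"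

definition IPO :: "('b, 'j) coset_system \<Rightarrow> 'w set \<Rightarrow> ('b \<Rightarrow> 'w \<Rightarrow> 'w) \<Rightarrow> bool" where
  "IPO \<beta> \<Omega> \<phi> \<longleftrightarrow> (\<forall>Q\<in>orbits (cgroup \<beta>) \<Omega> \<phi>. \<exists>w\<in>Q. IPO_point \<beta> \<phi> w)"


section \<open>Wreath products\<close>

definition semidirect ::
    "('n, 'c) monoid_scheme \<Rightarrow> ('h, 'd) monoid_scheme \<Rightarrow> ('h \<Rightarrow> 'n \<Rightarrow> 'n) \<Rightarrow> ('n \<times> 'h) monoid" where
  "semidirect N H \<theta> =
     \<lparr>carrier = carrier N \<times> carrier H,
      monoid.mult = (\<lambda>(n, h) (n', h'). (n \<otimes>\<^bsub>N\<^esub> \<theta> h n', h \<otimes>\<^bsub>H\<^esub> h')),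
      one = (\<one>\<^bsub>N\<^esub>, \<one>\<^bsub>H\<^esub>)\<rparr>"

definition permute_coords ::
    "('b, 'd) monoid_scheme \<Rightarrow> 'w set \<Rightarrow> ('b \<Rightarrow> 'w \<Rightarrow> 'w) \<Rightarrow> 'b \<Rightarrow> ('w \<Rightarrow> 'a) \<Rightarrow> 'w \<Rightarrow> 'a" where
  "permute_coords B \<Omega> \<phi> b a = (\<lambda>w\<in>\<Omega>. a (\<phi> (inv\<^bsub>B\<^esub> b) w))"

definition wreath_group ::
    "('a, 'c) monoid_scheme \<Rightarrow> ('b, 'd) monoid_scheme \<Rightarrow> 'w set \<Rightarrow> ('b \<Rightarrow> 'w \<Rightarrow> 'w) \<Rightarrow>
     (('w \<Rightarrow> 'a) \<times> 'b) monoid" where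
  "wreath_group A B \<Omega> \<phi> = semidirect (product_group \<Omega> (\<lambda>_. A)) B (permute_coords B \<Omega> \<phi>)"

definition product_system ::
    "('a, 'i) coset_system \<Rightarrow> 'w set \<Rightarrow> ('w \<Rightarrow> 'a, 'i \<times> 'w) coset_system" where
  "product_system \<alpha> \<Omega> =
     \<lparr>cgroup = product_group \<Omega> (\<lambda>_. cgroup \<alpha>),
      ctypes = ctypes \<alpha> \<times> \<Omega>,
      csub = (\<lambda>(j, l). {a \<in> carrier (product_group \<Omega> (\<lambda>_. cgroup \<alpha>)). a l \<in> csub \<alpha> j})\<rparr>"

definition type_action ::
    "('a, 'i) coset_system \<Rightarrow> 'w set \<Rightarrow> ('b \<Rightarrow> 'w \<Rightarrow> 'w) \<Rightarrow> 'b \<Rightarrow> 'i \<times> 'w \<Rightarrow> 'i \<times> 'w" where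
  "type_action \<alpha> \<Omega> \<phi> b = (\<lambda>(j, l)\<in>ctypes \<alpha> \<times> \<Omega>. (j, \<phi> b l))"

definition type_orbits ::
    "('a, 'i) coset_system \<Rightarrow> ('b, 'j) coset_system \<Rightarrow> 'w set \<Rightarrow> ('b \<Rightarrow> 'w \<Rightarrow> 'w) \<Rightarrow>
     ('i \<times> 'w) set set" where
  "type_orbits \<alpha> \<beta> \<Omega> \<phi> = orbits (cgroup \<beta>) (ctypes \<alpha> \<times> \<Omega>) (type_action \<alpha> \<Omega> \<phi>)"

definition admissible_representatives ::
    "('a, 'i) coset_system \<Rightarrow> ('b, 'j) coset_system \<Rightarrow> 'w set \<Rightarrow> ('b \<Rightarrow> 'w \<Rightarrow> 'w) \<Rightarrow>
     (('i \<times> 'w) set \<Rightarrow> 'i \<times> 'w) \<Rightarrow> bool" where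
  "admissible_representatives \<alpha> \<beta> \<Omega> \<phi> rep \<longleftrightarrow>
     (\<forall>L\<in>type_orbits \<alpha> \<beta> \<Omega> \<phi>. rep L \<in> L \<and> IPO_point \<beta> (type_action \<alpha> \<Omega> \<phi>) (rep L))"

text \<open>As sets, the semidirect products \<open>S \<rtimes> H\<close> of subgroups are the products \<open>S \<times> H\<close>.\<close>

definition wreath_system ::
    "('a, 'i) coset_system \<Rightarrow> ('b, 'j) coset_system \<Rightarrow> 'w set \<Rightarrow> ('b \<Rightarrow> 'w \<Rightarrow> 'w) \<Rightarrow>
     (('i \<times> 'w) set \<Rightarrow> 'i \<times> 'w) \<Rightarrow>
     (('w \<Rightarrow> 'a) \<times> 'b, ('i \<times> 'w) set + 'j) coset_system" where
  "wreath_system \<alpha> \<beta> \<Omega> \<phi> rep =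
     (let K = type_orbits \<alpha> \<beta> \<Omega> \<phi>;
          Abar = parabolic (product_system \<alpha> \<Omega>)
      in \<lparr>cgroup = wreath_group (cgroup \<alpha>) (cgroup \<beta>) \<Omega> \<phi>,
          ctypes = K <+> ctypes \<beta>,
          csub = (\<lambda>x. case x of
              Inl L \<Rightarrow> Abar L \<times> carrier (cgroup \<beta>)
            | Inr i \<Rightarrow>
                Abar (\<Union>L\<in>K. L - sub_orbit (cgroup \<beta>) (csub \<beta> i) (type_action \<alpha> \<Omega> \<phi>) (rep L))
                  \<times> csub \<beta> i)\<rparr>)"


subsection \<open>Well-definedness\<close>

lemma coset_incidence_is_incidence_system:
  assumes "is_coset_system C"
  shows "is_incidence_system (coset_incidence C)"
proof -
  interpret G: group "cgroup C" using assms by (simp add: is_coset_system_def)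
  have sg: "subgroup (csub C i) (cgroup C)" if "i \<in> ctypes C" for i
    using assms that by (simp add: is_coset_system_def)
  have refl: "X \<noteq> {}" if "i \<in> ctypes C" "X \<in> lcosets\<^bsub>cgroup C\<^esub> (csub C i)" for i X
    using that G.lcos_self[OF _ sg] by (auto simp: LCOSETS_def)
  have dist: "X = Y"
    if "i \<in> ctypes C" "X \<in> lcosets\<^bsub>cgroup C\<^esub> (csub C i)" "Y \<in> lcosets\<^bsub>cgroup C\<^esub> (csub C i)"
       "X \<inter> Y \<noteq> {}" for i X Y
  proof -
    note as = that
    obtain x y where x: "x \<in> carrier (cgroup C)" "X = x <#\<^bsub>cgroup C\<^esub> csub C i"
      and y: "y \<in> carrier (cgroup C)" "Y = y <#\<^bsub>cgroup C\<^esub> csub C i"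
      using as(2,3) unfolding LCOSETS_def by blast
    obtain z where z: "z \<in> X" "z \<in> Y" using as(4) by blast
    show "X = Y"
      using G.l_repr_independence[OF _ x(1) sg[OF that(1)]] G.l_repr_independence[OF _ y(1) sg[OF that(1)]]
        x y z by metis
  qed
  show ?thesis
    unfolding is_incidence_system_def coset_incidence_def
    using assms refl dist by (fastforce simp: is_coset_system_def)
qed

context
  fixes \<alpha> :: "('a, 'i) coset_system" and \<beta> :: "('b, 'j) coset_system"
    and \<Omega> :: "'w set" and \<phi> :: "'b \<Rightarrow> 'w \<Rightarrow> 'w"
  assumes \<alpha>: "is_coset_system \<alpha>" and \<beta>: "is_coset_system \<beta>"
    and fin: "finite \<Omega>" and act: "group_action (cgroup \<beta>) \<Omega> \<phi>"
begin

interpretation A: group "cgroup \<alpha>" using \<alpha> by (simp add: is_coset_system_def)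
interpretation B: group "cgroup \<beta>" using \<beta> by (simp add: is_coset_system_def)
interpretation act: group_action "cgroup \<beta>" \<Omega> \<phi> by (rule act)

lemma act_closed: "b \<in> carrier (cgroup \<beta>) \<Longrightarrow> w \<in> \<Omega> \<Longrightarrow> \<phi> b w \<in> \<Omega>"
  using act.element_image by blast

lemma act_one: "w \<in> \<Omega> \<Longrightarrow> \<phi> \<one>\<^bsub>cgroup \<beta>\<^esub> w = w"
  by (metis act.id_eq_one restrict_apply')

lemma type_action_group_action:
  "group_action (cgroup \<beta>) (ctypes \<alpha> \<times> \<Omega>) (type_action \<alpha> \<Omega> \<phi>)"
proof -
  let ?E = "ctypes \<alpha> \<times> \<Omega>"
  let ?t = "type_action \<alpha> \<Omega> \<phi>"
  have mult: "?t (g \<otimes>\<^bsub>cgroup \<beta>\<^esub> h) = compose ?E (?t g) (?t h)"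
    if "g \<in> carrier (cgroup \<beta>)" "h \<in> carrier (cgroup \<beta>)" for g h
    using that by (auto simp: fun_eq_iff type_action_def compose_def act_closed act.composition_rule)
  have one: "?t \<one>\<^bsub>cgroup \<beta>\<^esub> = (\<lambda>x\<in>?E. x)"
    by (auto simp: fun_eq_iff type_action_def act_one)
  have maps: "?t g \<in> ?E \<rightarrow> ?E" if "g \<in> carrier (cgroup \<beta>)" for g
    using that by (auto simp: type_action_def act_closed)
  have inverse: "?t (inv\<^bsub>cgroup \<beta>\<^esub> g) (?t g x) = x \<and> ?t g (?t (inv\<^bsub>cgroup \<beta>\<^esub> g) x) = x"
    if "g \<in> carrier (cgroup \<beta>)" "x \<in> ?E" for g x
  proof -
    have "?t (inv\<^bsub>cgroup \<beta>\<^esub> g) (?t g x) = ?t \<one>\<^bsub>cgroup \<beta>\<^esub> x"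
      using mult[of "inv\<^bsub>cgroup \<beta>\<^esub> g" g] that compose_eq[OF that(2), of "?t (inv\<^bsub>cgroup \<beta>\<^esub> g)" "?t g"]
      by simp
    moreover have "?t g (?t (inv\<^bsub>cgroup \<beta>\<^esub> g) x) = ?t \<one>\<^bsub>cgroup \<beta>\<^esub> x"
      using mult[of g "inv\<^bsub>cgroup \<beta>\<^esub> g"] that compose_eq[OF that(2), of "?t g" "?t (inv\<^bsub>cgroup \<beta>\<^esub> g)"]
      by simp
    ultimately show ?thesis using that one by simp
  qed
  have bij: "?t g \<in> Bij ?E" if g: "g \<in> carrier (cgroup \<beta>)" for g
  proof -
    have "bij_betw (?t g) ?E ?E"
      by (rule bij_betw_byWitness[where f' = "?t (inv\<^bsub>cgroup \<beta>\<^esub> g)"])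
        (use inverse[OF g] funcset_image[OF maps[OF g]] funcset_image[OF maps[OF B.inv_closed[OF g]]] in blast)+
    then show ?thesis by (simp add: Bij_def type_action_def)
  qed
  show ?thesis
    unfolding group_action_def group_hom_def group_hom_axioms_def
    using B.is_group group_BijGroup bij mult
    by (auto simp: hom_def BijGroup_def)
qed

lemma type_orbits_finite: "finite (type_orbits \<alpha> \<beta> \<Omega> \<phi>)"
proof -
  have "type_orbits \<alpha> \<beta> \<Omega> \<phi> \<subseteq> (\<lambda>x. orbit (cgroup \<beta>) (type_action \<alpha> \<Omega> \<phi>) x) ` (ctypes \<alpha> \<times> \<Omega>)"
    by (auto simp: type_orbits_def orbits_def)
  then show ?thesis using \<alpha> fin by (auto simp: is_coset_system_def intro: finite_subset)
qed

lemma permute_coords_mult: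
  assumes "g \<in> carrier (cgroup \<beta>)" "h \<in> carrier (cgroup \<beta>)"
  shows "permute_coords (cgroup \<beta>) \<Omega> \<phi> (g \<otimes>\<^bsub>cgroup \<beta>\<^esub> h) a =
         permute_coords (cgroup \<beta>) \<Omega> \<phi> g (permute_coords (cgroup \<beta>) \<Omega> \<phi> h a)"
  using assms
  by (auto simp: fun_eq_iff permute_coords_def act_closed B.inv_mult_group act.composition_rule)

lemma permute_coords_closed:
  assumes "b \<in> carrier (cgroup \<beta>)" "a \<in> \<Omega> \<rightarrow>\<^sub>E carrier (cgroup \<alpha>)"
  shows "permute_coords (cgroup \<beta>) \<Omega> \<phi> b a \<in> \<Omega> \<rightarrow>\<^sub>E carrier (cgroup \<alpha>)"
  using assms by (auto simp: permute_coords_def act_closed PiE_iff)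

lemma permute_coords_one:
  assumes "a \<in> \<Omega> \<rightarrow>\<^sub>E carrier (cgroup \<alpha>)"
  shows "permute_coords (cgroup \<beta>) \<Omega> \<phi> \<one>\<^bsub>cgroup \<beta>\<^esub> a = a"
  using assms by (auto simp: fun_eq_iff permute_coords_def act_one PiE_iff extensional_def)

lemma permute_coords_distrib:
  assumes "b \<in> carrier (cgroup \<beta>)"
  shows "permute_coords (cgroup \<beta>) \<Omega> \<phi> b (\<lambda>w\<in>\<Omega>. x w \<otimes>\<^bsub>cgroup \<alpha>\<^esub> y w) =
    (\<lambda>w\<in>\<Omega>. permute_coords (cgroup \<beta>) \<Omega> \<phi> b x w \<otimes>\<^bsub>cgroup \<alpha>\<^esub> permute_coords (cgroup \<beta>) \<Omega> \<phi> b y w)"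
  using assms by (auto simp: fun_eq_iff permute_coords_def act_closed)

lemma wreath_group_is_group: "group (wreath_group (cgroup \<alpha>) (cgroup \<beta>) \<Omega> \<phi>)"
proof -
  let ?P = "product_group \<Omega> (\<lambda>_. cgroup \<alpha>)"
  let ?\<theta> = "permute_coords (cgroup \<beta>) \<Omega> \<phi>"
  interpret P: group ?P by simp
  have cl: "?\<theta> b a \<in> carrier ?P" if "b \<in> carrier (cgroup \<beta>)" "a \<in> carrier ?P" for a b
    using permute_coords_closed that by simp
  have on: "?\<theta> \<one>\<^bsub>cgroup \<beta>\<^esub> a = a" if "a \<in> carrier ?P" for a
    using permute_coords_one that by simp
  have di: "?\<theta> b (x \<otimes>\<^bsub>?P\<^esub> y) = ?\<theta> b x \<otimes>\<^bsub>?P\<^esub> ?\<theta> b y" if "b \<in> carrier (cgroup \<beta>)" for b x y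
    using permute_coords_distrib[OF that] by simp
  have oo: "?\<theta> b \<one>\<^bsub>?P\<^esub> = \<one>\<^bsub>?P\<^esub>" if "b \<in> carrier (cgroup \<beta>)" for b
    using that by (auto simp: fun_eq_iff permute_coords_def act_closed)
  have linv: "\<exists>u\<in>carrier ?P. \<exists>v\<in>carrier (cgroup \<beta>).
      u \<otimes>\<^bsub>?P\<^esub> ?\<theta> v a = \<one>\<^bsub>?P\<^esub> \<and> v \<otimes>\<^bsub>cgroup \<beta>\<^esub> b = \<one>\<^bsub>cgroup \<beta>\<^esub>"
    if "a \<in> carrier ?P" "b \<in> carrier (cgroup \<beta>)" for a b
    using cl[OF B.inv_closed[OF that(2)] that(1)] that P.l_inv P.inv_closed B.l_inv B.inv_closed by blast
  note [simp del] = carrier_product_group mult_product_group one_product_group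
  show ?thesis
    unfolding wreath_group_def semidirect_def
    by (rule groupI)
      (use linv in \<open>auto simp: cl on di oo permute_coords_mult P.m_assoc B.m_assoc\<close>)
qed

lemma parabolic_product_subgroup:
  assumes "T \<subseteq> ctypes \<alpha> \<times> \<Omega>"
  shows "subgroup (parabolic (product_system \<alpha> \<Omega>) T) (product_group \<Omega> (\<lambda>_. cgroup \<alpha>))"
proof -
  let ?P = "product_group \<Omega> (\<lambda>_. cgroup \<alpha>)"
  interpret P: group ?P by simp
  have sg: "subgroup (csub \<alpha> j) (cgroup \<alpha>)" if "j \<in> ctypes \<alpha>" for j
    using \<alpha> that by (simp add: is_coset_system_def)
  have inv: "inv\<^bsub>?P\<^esub> a = (\<lambda>w\<in>\<Omega>. inv\<^bsub>cgroup \<alpha>\<^esub> a w)" if "a \<in> \<Omega> \<rightarrow>\<^sub>E carrier (cgroup \<alpha>)" for a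
    using that by simp
  have "subgroup (csub (product_system \<alpha> \<Omega>) t) ?P" if tT: "t \<in> T" for t
  proof -
    obtain j l where t: "t = (j, l)" "j \<in> ctypes \<alpha>" "l \<in> \<Omega>"
      using assms tT by auto
    show ?thesis
    proof (rule P.subgroupI)
      have "\<one>\<^bsub>?P\<^esub> \<in> csub (product_system \<alpha> \<Omega>) t"
        using t subgroup.one_closed[OF sg] P.one_closed by (simp add: product_system_def)
      then show "csub (product_system \<alpha> \<Omega>) t \<noteq> {}" by blast
    next
      fix a assume a: "a \<in> csub (product_system \<alpha> \<Omega>) t"
      then show "inv\<^bsub>?P\<^esub> a \<in> csub (product_system \<alpha> \<Omega>) t"
        using t subgroup.m_inv_closed[OF sg] P.inv_closed[of a]
        by (simp add: product_system_def inv del: inv_product_group)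
    next
      fix a b assume "a \<in> csub (product_system \<alpha> \<Omega>) t" "b \<in> csub (product_system \<alpha> \<Omega>) t"
      then show "a \<otimes>\<^bsub>?P\<^esub> b \<in> csub (product_system \<alpha> \<Omega>) t"
        using t subgroup.m_closed[OF sg] P.m_closed[of a b] by (simp add: product_system_def)
    qed (auto simp: t product_system_def)
  qed
  then have "subgroup (\<Inter>(insert (carrier ?P) (csub (product_system \<alpha> \<Omega>) ` T))) ?P"
    by (intro P.subgroups_Inter) (use P.subgroup_self in auto)
  then show ?thesis by (simp add: parabolic_def product_system_def)
qed

lemma parabolic_product_invariant:
  assumes "b \<in> carrier (cgroup \<beta>)" "T \<subseteq> ctypes \<alpha> \<times> \<Omega>"
    and "\<And>t. t \<in> T \<Longrightarrow> type_action \<alpha> \<Omega> \<phi> (inv\<^bsub>cgroup \<beta>\<^esub> b) t \<in> T"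
    and "a \<in> parabolic (product_system \<alpha> \<Omega>) T"
  shows "permute_coords (cgroup \<beta>) \<Omega> \<phi> b a \<in> parabolic (product_system \<alpha> \<Omega>) T"
proof -
  have a: "a \<in> \<Omega> \<rightarrow>\<^sub>E carrier (cgroup \<alpha>)" "\<And>j l. (j, l) \<in> T \<Longrightarrow> a l \<in> csub \<alpha> j"
    using assms(4) by (auto simp: parabolic_def product_system_def)
  have "permute_coords (cgroup \<beta>) \<Omega> \<phi> b a l \<in> csub \<alpha> j" if "(j, l) \<in> T" for j l
    using a(2)[of j "\<phi> (inv\<^bsub>cgroup \<beta>\<^esub> b) l"] assms(3)[OF that] assms(2) that
    by (auto simp: permute_coords_def type_action_def split: if_splits)
  then show ?thesis
    using permute_coords_closed[OF assms(1) a(1)]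
    by (auto simp: parabolic_def product_system_def)
qed

lemma semidirect_subgroup:
  assumes H: "subgroup H (cgroup \<beta>)" and S: "subgroup S (product_group \<Omega> (\<lambda>_. cgroup \<alpha>))"
    and inv: "\<And>b a. b \<in> H \<Longrightarrow> a \<in> S \<Longrightarrow> permute_coords (cgroup \<beta>) \<Omega> \<phi> b a \<in> S"
  shows "subgroup (S \<times> H) (wreath_group (cgroup \<alpha>) (cgroup \<beta>) \<Omega> \<phi>)"
proof -
  let ?P = "product_group \<Omega> (\<lambda>_. cgroup \<alpha>)"
  let ?W = "wreath_group (cgroup \<alpha>) (cgroup \<beta>) \<Omega> \<phi>"
  let ?\<theta> = "permute_coords (cgroup \<beta>) \<Omega> \<phi>"
  interpret P: group ?P by simp
  interpret W: group ?W by (rule wreath_group_is_group)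
  interpret H: subgroup H "cgroup \<beta>" by (rule H)
  interpret S: subgroup S ?P by (rule S)
  note [simp del] = carrier_product_group mult_product_group one_product_group
  have carr: "x \<in> carrier ?W" if "x \<in> S \<times> H" for x
    using that S.subset H.subset by (auto simp: wreath_group_def semidirect_def)
  show ?thesis
  proof (rule W.subgroupI)
    show "S \<times> H \<subseteq> carrier ?W" using carr by blast
    show "S \<times> H \<noteq> {}" using S.one_closed H.one_closed by blast
    fix x y assume x: "x \<in> S \<times> H"
    obtain a b where ab: "x = (a, b)" "a \<in> S" "b \<in> H" using x by blast
    let ?y = "(?\<theta> (inv\<^bsub>cgroup \<beta>\<^esub> b) (inv\<^bsub>?P\<^esub> a), inv\<^bsub>cgroup \<beta>\<^esub> b)"
    have y: "?y \<in> S \<times> H" using ab inv by simp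
    have one: "?\<theta> \<one>\<^bsub>cgroup \<beta>\<^esub> (inv\<^bsub>?P\<^esub> a) = inv\<^bsub>?P\<^esub> a"
      using permute_coords_one[of "inv\<^bsub>?P\<^esub> a"] P.inv_closed[OF S.mem_carrier[OF ab(2)]]
      unfolding carrier_product_group by blast
    have "x \<otimes>\<^bsub>?W\<^esub> ?y = \<one>\<^bsub>?W\<^esub>"
      using ab one S.mem_carrier H.mem_carrier
      by (simp add: wreath_group_def semidirect_def permute_coords_mult[symmetric])
    then have "inv\<^bsub>?W\<^esub> x = ?y"
      by (rule W.inv_equality[OF W.inv_comm[OF _ carr[OF x] carr[OF y]] carr[OF x] carr[OF y]])
    then show "inv\<^bsub>?W\<^esub> x \<in> S \<times> H" using y by simp
    assume "y \<in> S \<times> H"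
    then show "x \<otimes>\<^bsub>?W\<^esub> y \<in> S \<times> H"
      using ab inv by (auto simp: wreath_group_def semidirect_def)
  qed
qed

lemma wreath_system_is_coset_system:
  assumes "admissible_representatives \<alpha> \<beta> \<Omega> \<phi> rep"
  shows "is_coset_system (wreath_system \<alpha> \<beta> \<Omega> \<phi> rep)"
proof -
  let ?K = "type_orbits \<alpha> \<beta> \<Omega> \<phi>"
  let ?t = "type_action \<alpha> \<Omega> \<phi>"
  interpret T: group_action "cgroup \<beta>" "ctypes \<alpha> \<times> \<Omega>" ?t
    by (rule type_action_group_action)
  have K: "L \<subseteq> ctypes \<alpha> \<times> \<Omega>" if "L \<in> ?K" for L
    using T.orbits_coverture that by (auto simp: type_orbits_def)
  have Kinv: "?t b x \<in> L" if as: "L \<in> ?K" "x \<in> L" "b \<in> carrier (cgroup \<beta>)" for L x b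
  proof -
    obtain z where z: "z \<in> ctypes \<alpha> \<times> \<Omega>" "L = orbit (cgroup \<beta>) ?t z"
      using as(1) by (auto simp: type_orbits_def orbits_def)
    obtain g where g: "g \<in> carrier (cgroup \<beta>)" "x = ?t g z"
      using as(2) z by (auto simp: orbit_def)
    have "?t b x = ?t (b \<otimes>\<^bsub>cgroup \<beta>\<^esub> g) z"
      using g z that(3) T.composition_rule by simp
    then show ?thesis using g z that(3) unfolding orbit_def by blast
  qed
  have so: "?t b y \<in> sub_orbit (cgroup \<beta>) H ?t x"
    if as: "subgroup H (cgroup \<beta>)" "b \<in> H" "x \<in> ctypes \<alpha> \<times> \<Omega>" "y \<in> sub_orbit (cgroup \<beta>) H ?t x" for H b x y
  proof -
    obtain h where h: "h \<in> H" "y = ?t h x" using as(4) by (auto simp: sub_orbit_def orbit_def)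
    have "?t b y = ?t (b \<otimes>\<^bsub>cgroup \<beta>\<^esub> h) x"
      using h that T.composition_rule subgroup.mem_carrier[OF that(1)] by simp
    then show ?thesis
      using h that subgroup.m_closed[OF that(1)] by (auto simp: sub_orbit_def orbit_def)
  qed
  have Linv: "subgroup (csub (wreath_system \<alpha> \<beta> \<Omega> \<phi> rep) (Inl L)) (wreath_group (cgroup \<alpha>) (cgroup \<beta>) \<Omega> \<phi>)"
    if L: "L \<in> ?K" for L
    unfolding wreath_system_def Let_def
    using semidirect_subgroup[OF B.subgroup_self parabolic_product_subgroup[OF K[OF L]]]
      parabolic_product_invariant[OF _ K[OF L]] Kinv[OF L] by simp
  have Rinv: "subgroup (csub (wreath_system \<alpha> \<beta> \<Omega> \<phi> rep) (Inr i)) (wreath_group (cgroup \<alpha>) (cgroup \<beta>) \<Omega> \<phi>)"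
    if i: "i \<in> ctypes \<beta>" for i
  proof -
    have H: "subgroup (csub \<beta> i) (cgroup \<beta>)" using \<beta> i by (simp add: is_coset_system_def)
    define U where "U = (\<Union>L\<in>?K. L - sub_orbit (cgroup \<beta>) (csub \<beta> i) ?t (rep L))"
    have U: "U \<subseteq> ctypes \<alpha> \<times> \<Omega>" using K by (auto simp: U_def)
    have inv: "?t b u \<in> U" if b: "b \<in> csub \<beta> i" and "u \<in> U" for b u
    proof -
      obtain L where L: "L \<in> ?K" "u \<in> L" "u \<notin> sub_orbit (cgroup \<beta>) (csub \<beta> i) ?t (rep L)"
        using \<open>u \<in> U\<close> by (auto simp: U_def)
      have r: "rep L \<in> ctypes \<alpha> \<times> \<Omega>"
        using assms K L(1) by (auto simp: admissible_representatives_def)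
      have bc: "b \<in> carrier (cgroup \<beta>)" using subgroup.mem_carrier[OF H b] .
      have "?t (inv\<^bsub>cgroup \<beta>\<^esub> b) (?t b u) = u"
        using T.orbit_sym_aux[OF bc _ refl, of u] U \<open>u \<in> U\<close> by blast
      then have "?t b u \<notin> sub_orbit (cgroup \<beta>) (csub \<beta> i) ?t (rep L)"
        using so[OF H subgroup.m_inv_closed[OF H b] r, of "?t b u"] L(3) by auto
      then show ?thesis using Kinv[OF L(1,2) bc] L(1) by (auto simp: U_def)
    qed
    have "subgroup (parabolic (product_system \<alpha> \<Omega>) U \<times> csub \<beta> i) (wreath_group (cgroup \<alpha>) (cgroup \<beta>) \<Omega> \<phi>)"
      by (rule semidirect_subgroup[OF H parabolic_product_subgroup[OF U]])
        (use parabolic_product_invariant[OF _ U] inv subgroup.mem_carrier[OF H]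
           subgroup.m_inv_closed[OF H] in blast)
    then show ?thesis by (simp add: wreath_system_def Let_def U_def)
  qed
  have "cgroup (wreath_system \<alpha> \<beta> \<Omega> \<phi> rep) = wreath_group (cgroup \<alpha>) (cgroup \<beta>) \<Omega> \<phi>"
    "ctypes (wreath_system \<alpha> \<beta> \<Omega> \<phi> rep) = ?K <+> ctypes \<beta>"
    by (simp_all add: wreath_system_def Let_def)
  then show ?thesis
    using Linv Rinv wreath_group_is_group type_orbits_finite \<beta>
    by (auto simp: is_coset_system_def)
qed

lemma admissible_representatives_exist:
  assumes "IPO \<beta> \<Omega> \<phi>"
  shows "\<exists>rep. admissible_representatives \<alpha> \<beta> \<Omega> \<phi> rep"
proof -
  let ?t = "type_action \<alpha> \<Omega> \<phi>"
  have so: "sub_orbit (cgroup \<beta>) H ?t (j, w) = Pair j ` sub_orbit (cgroup \<beta>) H \<phi> w"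
    if "j \<in> ctypes \<alpha>" "w \<in> \<Omega>" for H j w
    using that by (auto simp: sub_orbit_def orbit_def type_action_def)
  have "\<exists>x\<in>L. IPO_point \<beta> ?t x" if LK: "L \<in> type_orbits \<alpha> \<beta> \<Omega> \<phi>" for L
  proof -
    obtain j l where L: "L = orbit (cgroup \<beta>) ?t (j, l)" "j \<in> ctypes \<alpha>" "l \<in> \<Omega>"
      using LK by (auto simp: type_orbits_def orbits_def)
    have inj: "inj (Pair j)" by (simp add: inj_on_def)
    obtain w where w: "w \<in> orbit (cgroup \<beta>) \<phi> l" "IPO_point \<beta> \<phi> w"
      using assms L(3) by (auto simp: IPO_def orbits_def)
    have "w \<in> \<Omega>" using w(1) L(3) by (auto simp: orbit_def act_closed)
    then have "IPO_point \<beta> ?t (j, w)"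
      using w(2) by (simp add: IPO_point_def so[OF L(2)] flip: image_Int[OF inj])
    moreover have "(j, w) \<in> L"
      using w(1) L by (auto simp: orbit_def type_action_def)
    ultimately show ?thesis by blast
  qed
  then show ?thesis unfolding admissible_representatives_def by metis
qed

end

end

theory Submission
  imports Defs
begin

text \<open>Flag-transitivity of a coset incidence system means that pairwise incident cosets have a common
  element; every flag is then a translate of a standard one, and residual connectedness, firmness and
  thinness (with trivial Borel subgroup) become statements about the parabolic subgroups \<open>G\<^sub>J\<close>.

  For the wreath product, a common element is found coordinate by coordinate, from the
  flag-transitivity of \<open>\<alpha>\<close> at each point of \<open>\<Omega>\<close> and that of \<open>\<beta>\<close>. By (IPO), the parabolic subgroup of
  type \<open>J\<close> consists of the \<open>(n, h)\<close> with \<open>h\<close> in \<open>B\<^sub>J\<close> and \<open>n\<close> in \<open>A\<^sub>j\<close> at \<open>l\<close> for all \<open>(j, l)\<close> outside the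
  \<open>B\<^sub>J\<close>-orbits of the representatives of the orbits \<open>L\<close> not in \<open>J\<close>. It is generated by its intersection
  with \<open>B\<close> and its elements supported at one point.\<close>

section \<open>Flag-transitive coset incidence systems\<close>

locale coset_incidence_system =
  fixes C :: "('g, 't) coset_system"
  assumes is_coset_system: "is_coset_system C"
begin

abbreviation G where "G \<equiv> cgroup C"
abbreviation I where "I \<equiv> ctypes C"
abbreviation lcoset (infixl "\<cdot>" 75) where "g \<cdot> H \<equiv> g <#\<^bsub>cgroup C\<^esub> H"

text \<open>All these cosets contain g, so they are pairwise incident. Under flag-transitivity every
  flag has this form.\<close>

definition coset_flag :: "'g \<Rightarrow> 't set \<Rightarrow> ('t \<times> 'g set) set" where
  "coset_flag g J = (\<lambda>j. (j, g \<cdot> csub C j)) ` J"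

sublocale G: group "cgroup C"
  using is_coset_system by (simp add: is_coset_system_def)

lemma finite_types: "finite I"
  using is_coset_system by (simp add: is_coset_system_def)

lemma csub_subgroup: "i \<in> I \<Longrightarrow> subgroup (csub C i) G"
  using is_coset_system by (simp add: is_coset_system_def)

lemma mem_lcoset:
  assumes "subgroup H G" "g \<in> carrier G"
  shows "z \<in> g \<cdot> H \<longleftrightarrow> z \<in> carrier G \<and> inv\<^bsub>G\<^esub> g \<otimes>\<^bsub>G\<^esub> z \<in> H"
  using assms subgroup.lcos_module_rev[OF assms(1) G.is_group] subgroup.lcos_module_imp[OF assms(1) G.is_group]
    subgroup.elemlcos_carrier[OF assms(1) G.is_group] by metis

lemma lcoset_eq:
  assumes "subgroup H G" "g \<in> carrier G" "z \<in> g \<cdot> H"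
  shows "g \<cdot> H = z \<cdot> H"
  using assms G.l_repr_independence by blast

lemma parabolic_subgroup:
  assumes "J \<subseteq> I"
  shows "subgroup (parabolic C J) G"
proof -
  have "subgroup (\<Inter>(insert (carrier G) (csub C ` J))) G"
    by (intro G.subgroups_Inter) (use G.subgroup_self csub_subgroup assms in auto)
  then show ?thesis by (simp add: parabolic_def)
qed

text \<open>Left translation is injective, so it commutes with the intersection defining G_J. For
  empty J only the carrier condition remains.\<close>

lemma mem_parabolic_lcoset:
  assumes "J \<subseteq> I" "g \<in> carrier G"
  shows "z \<in> g \<cdot> parabolic C J \<longleftrightarrow> z \<in> carrier G \<and> (\<forall>j\<in>J. z \<in> g \<cdot> csub C j)"
proof -
  have "z \<in> g \<cdot> csub C j \<longleftrightarrow> z \<in> carrier G \<and> inv\<^bsub>G\<^esub> g \<otimes>\<^bsub>G\<^esub> z \<in> csub C j" if "j \<in> J" for j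
    using mem_lcoset[OF csub_subgroup assms(2)] assms(1) that by blast
  then show ?thesis
    using assms(2) unfolding mem_lcoset[OF parabolic_subgroup[OF assms(1)] assms(2)]
    by (auto simp: parabolic_def)
qed

lemma coset_incidence_simps [simp]:
  "types (coset_incidence C) = I" "type_of (coset_incidence C) = fst"
  "inc (coset_incidence C) x y \<longleftrightarrow> snd x \<inter> snd y \<noteq> {}"
  by (simp_all add: coset_incidence_def)

lemma elems_coset_incidence:
  "(i, X) \<in> elems (coset_incidence C) \<longleftrightarrow> i \<in> I \<and> (\<exists>g\<in>carrier G. X = g \<cdot> csub C i)"
  by (auto simp: coset_incidence_def LCOSETS_def)

lemma elems_cases:
  assumes "x \<in> elems (coset_incidence C)"
  obtains i g where "i \<in> I" "g \<in> carrier G" "x = (i, g \<cdot> csub C i)"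
  using assms elems_coset_incidence[of "fst x" "snd x"] that by (metis prod.collapse)

lemma coset_flag_flag:
  assumes "g \<in> carrier G" "J \<subseteq> I"
  shows "flag (coset_incidence C) (coset_flag g J)" "fst ` coset_flag g J = J"
proof -
  have "g \<in> g \<cdot> csub C j" if "j \<in> J" for j
    using G.lcos_self[OF assms(1) csub_subgroup] that assms(2) by blast
  then have "\<forall>x\<in>coset_flag g J. \<forall>y\<in>coset_flag g J. inc (coset_incidence C) x y"
    by (auto simp: coset_flag_def)
  moreover have "coset_flag g J \<subseteq> elems (coset_incidence C)"
    using assms by (auto simp: coset_flag_def elems_coset_incidence)
  ultimately show "flag (coset_incidence C) (coset_flag g J)"
    by (simp add: flag_def)
qed (simp add: coset_flag_def image_comp)

lemma left_mult_coset_flag: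
  assumes "g \<in> carrier G" "h \<in> carrier G" "J \<subseteq> I"
  shows "left_mult C g ` coset_flag h J = coset_flag (g \<otimes>\<^bsub>G\<^esub> h) J"
proof -
  have "g \<cdot> (h \<cdot> csub C j) = (g \<otimes>\<^bsub>G\<^esub> h) \<cdot> csub C j" if "j \<in> J" for j
    using G.lcos_m_assoc[OF subgroup.subset[OF csub_subgroup]] assms that by blast
  then show ?thesis
    by (auto simp: coset_flag_def left_mult_def image_comp image_iff)
qed

lemma flag_types: "flag (coset_incidence C) F \<Longrightarrow> fst ` F \<subseteq> I"
  by (auto simp: flag_def elems_coset_incidence)

text \<open>The subgroups G_j with j in J form a flag of type J, and its translate by g is
  \<open>coset_flag g J\<close>. Transitivity on the flags of type J thus says that all of them are
  such translates.\<close>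

lemma flag_transitive_iff_coset_flag:
  "flag_transitive C \<longleftrightarrow>
     (\<forall>F. flag (coset_incidence C) F \<longrightarrow> (\<exists>g\<in>carrier G. F = coset_flag g (fst ` F)))"
proof
  assume ft: "flag_transitive C"
  show "\<forall>F. flag (coset_incidence C) F \<longrightarrow> (\<exists>g\<in>carrier G. F = coset_flag g (fst ` F))"
  proof (intro allI impI)
    fix F assume F: "flag (coset_incidence C) F"
    note J = flag_types[OF F]
    have "\<exists>g\<in>carrier G. left_mult C g ` coset_flag \<one>\<^bsub>G\<^esub> (fst ` F) = F"
      using ft F J coset_flag_flag[OF G.one_closed J] unfolding flag_transitive_def flag_type_def
      by simp
    then show "\<exists>g\<in>carrier G. F = coset_flag g (fst ` F)"
      using left_mult_coset_flag[OF _ G.one_closed J] G.r_one by metis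
  qed
next
  assume cf: "\<forall>F. flag (coset_incidence C) F \<longrightarrow> (\<exists>g\<in>carrier G. F = coset_flag g (fst ` F))"
  show "flag_transitive C"
    unfolding flag_transitive_def
  proof (intro allI impI, elim conjE)
    fix J F F'
    assume J: "J \<subseteq> I" and F: "flag (coset_incidence C) F" "flag_type (coset_incidence C) F = J"
      and F': "flag (coset_incidence C) F'" "flag_type (coset_incidence C) F' = J"
    have "fst ` F = J" "fst ` F' = J"
      using F(2) F'(2) by (simp_all add: flag_type_def)
    then obtain g h where g: "g \<in> carrier G" "F = coset_flag g J" and h: "h \<in> carrier G" "F' = coset_flag h J"
      using cf F(1) F'(1) by metis
    have "left_mult C (h \<otimes>\<^bsub>G\<^esub> inv\<^bsub>G\<^esub> g) ` F = F'"
      using g h J by (simp add: left_mult_coset_flag G.m_assoc)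
    then show "\<exists>k\<in>carrier G. left_mult C k ` F = F'" using g h by blast
  qed
qed

text \<open>Flags are given here by representatives of their cosets, the form in which the wreath
  product can be treated coordinate by coordinate. A common element z serves as a representative of
  every member of the flag, which is then \<open>coset_flag z J\<close>.\<close>

lemma flag_transitiveI:
  assumes "\<And>T. T \<subseteq> I \<times> carrier G \<Longrightarrow>
      (\<And>i g j h. (i, g) \<in> T \<Longrightarrow> (j, h) \<in> T \<Longrightarrow> g \<cdot> csub C i \<inter> h \<cdot> csub C j \<noteq> {}) \<Longrightarrow>
      \<exists>z\<in>carrier G. \<forall>(i, g)\<in>T. z \<in> g \<cdot> csub C i"
  shows "flag_transitive C"
  unfolding flag_transitive_iff_coset_flag
proof (intro allI impI)
  fix F assume F: "flag (coset_incidence C) F"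
  \<comment> \<open>\<open>T\<close> collects every representative of every member of
    \<open>F\<close>, which avoids choosing one.\<close>
  define T where "T = {(i, g). i \<in> I \<and> g \<in> carrier G \<and> (i, g \<cdot> csub C i) \<in> F}"
  have "\<exists>z\<in>carrier G. \<forall>(i, g)\<in>T. z \<in> g \<cdot> csub C i"
    by (rule assms) (use F in \<open>fastforce simp: T_def flag_def\<close>)+
  then obtain z where z: "z \<in> carrier G" "\<And>i g. (i, g) \<in> T \<Longrightarrow> z \<in> g \<cdot> csub C i"
    by blast
  have "X = z \<cdot> csub C i" if "(i, X) \<in> F" for i X
  proof -
    have "(i, X) \<in> elems (coset_incidence C)" using that F by (auto simp: flag_def)
    then obtain g where g: "i \<in> I" "g \<in> carrier G" "X = g \<cdot> csub C i"
      by (elim elems_cases) simp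
    then have "z \<in> g \<cdot> csub C i" using z(2) that by (simp add: T_def)
    then show ?thesis using lcoset_eq[OF csub_subgroup[OF g(1)] g(2)] g(3) by simp
  qed
  then have "(\<lambda>x. (fst x, z \<cdot> csub C (fst x))) ` F = (\<lambda>x. x) ` F"
    by (intro image_cong) auto
  then have "F = coset_flag z (fst ` F)" by (simp add: coset_flag_def image_image)
  then show "\<exists>g\<in>carrier G. F = coset_flag g (fst ` F)" using z(1) by blast
qed

end

section \<open>Flags, chambers and residues under flag-transitivity\<close>

locale flag_transitive_system = coset_incidence_system C for C :: "('g, 't) coset_system" +
  assumes flag_transitive: "flag_transitive C"
begin

lemma flag_cases:
  assumes "flag (coset_incidence C) F"
  obtains g J where "g \<in> carrier G" "J \<subseteq> I" "F = coset_flag g J" "fst ` F = J"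
proof -
  obtain g where g: "g \<in> carrier G" "F = coset_flag g (fst ` F)"
    using flag_transitive assms unfolding flag_transitive_iff_coset_flag by meson
  show thesis by (rule that[OF g(1) flag_types[OF assms] g(2) refl])
qed

text \<open>Converse of \<open>flag_transitiveI\<close>. Types and cosets may be repeated in
  \<open>T\<close>: the listed cosets form a flag, hence some \<open>coset_flag z J\<close>, and z
  lies in all its members.\<close>

lemma common_element:
  assumes "T \<subseteq> I \<times> carrier G"
    and "\<And>i g j h. (i, g) \<in> T \<Longrightarrow> (j, h) \<in> T \<Longrightarrow> g \<cdot> csub C i \<inter> h \<cdot> csub C j \<noteq> {}"
  shows "\<exists>z\<in>carrier G. \<forall>(i, g)\<in>T. z \<in> g \<cdot> csub C i"
proof -
  have "flag (coset_incidence C) ((\<lambda>(i, g). (i, g \<cdot> csub C i)) ` T)"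
    using assms by (fastforce simp: flag_def elems_coset_incidence)
  then obtain z J where z: "z \<in> carrier G" "J \<subseteq> I" "(\<lambda>(i, g). (i, g \<cdot> csub C i)) ` T = coset_flag z J"
    by (elim flag_cases)
  have "z \<in> g \<cdot> csub C i" if "(i, g) \<in> T" for i g
  proof -
    have "(i, g \<cdot> csub C i) \<in> coset_flag z J" using that z(3) by force
    then have "i \<in> J" "g \<cdot> csub C i = z \<cdot> csub C i" by (auto simp: coset_flag_def)
    then show ?thesis using G.lcos_self[OF z(1) csub_subgroup] z(2) by blast
  qed
  then show ?thesis using z(1) by blast
qed

text \<open>Any flag \<open>coset_flag g J\<close> extends to the chamber
  \<open>coset_flag g I\<close>, so a maximal flag equals this chamber.\<close>

lemma is_geometry: "geometry (coset_incidence C)"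
  unfolding geometry_def
proof (intro conjI allI impI)
  show "is_incidence_system (coset_incidence C)"
    by (rule coset_incidence_is_incidence_system[OF is_coset_system])
next
  fix F assume F: "maximal_flag (coset_incidence C) F"
  then obtain g J where g: "g \<in> carrier G" "J \<subseteq> I" "F = coset_flag g J"
    unfolding maximal_flag_def using flag_cases by metis
  have "F \<subseteq> coset_flag g I" using g by (auto simp: coset_flag_def)
  then have "F = coset_flag g I"
    using F coset_flag_flag(1)[OF g(1) subset_refl] unfolding maximal_flag_def by blast
  then show "chamber (coset_incidence C) F"
    using coset_flag_flag[OF g(1) subset_refl]
    by (simp add: chamber_def flag_type_def)
qed

text \<open>A coset incident to every member of the flag meets all of them in one element h of g
  G_J, and h can be taken as its representative. A coset of a type in J would then be a member of
  the flag itself.\<close>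

lemma elems_residue:
  assumes "g \<in> carrier G" "J \<subseteq> I"
  shows "elems (residue (coset_incidence C) (coset_flag g J)) =
    {(t, h \<cdot> csub C t) | t h. t \<in> I - J \<and> h \<in> g \<cdot> parabolic C J}" (is "?R = ?S")
proof (intro subset_antisym subsetI)
  fix x assume x: "x \<in> ?R"
  then have "x \<in> elems (coset_incidence C)" by (simp add: residue_def)
  then obtain t k where t: "t \<in> I" "k \<in> carrier G" "x = (t, k \<cdot> csub C t)"
    by (rule elems_cases)
  have meet: "k \<cdot> csub C t \<inter> g \<cdot> csub C j \<noteq> {}" if "j \<in> J" for j
    using x t that by (auto simp: residue_def coset_flag_def)
  have self: "k \<in> k \<cdot> csub C t" "\<And>j. j \<in> J \<Longrightarrow> g \<in> g \<cdot> csub C j"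
    using G.lcos_self csub_subgroup t assms by blast+
  \<comment> \<open>The members of the flag, all represented by g, together with the new coset
    represented by k, are pairwise incident.\<close>
  have "\<exists>z\<in>carrier G. \<forall>(i, g)\<in>insert (t, k) (J \<times> {g}). z \<in> g \<cdot> csub C i"
    by (rule common_element) (use t assms meet self in blast)+
  then obtain h where h: "h \<in> carrier G" "h \<in> k \<cdot> csub C t" "\<And>j. j \<in> J \<Longrightarrow> h \<in> g \<cdot> csub C j"
    by blast
  have xh: "x = (t, h \<cdot> csub C t)" using lcoset_eq[OF csub_subgroup] t h(2) by blast
  have "t \<notin> J"
  proof
    assume "t \<in> J"
    then have "x \<in> coset_flag g J"
      using lcoset_eq[OF csub_subgroup[OF t(1)] assms(1) h(3)] xh by (auto simp: coset_flag_def)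
    then show False using x by (simp add: residue_def)
  qed
  then show "x \<in> ?S" using xh t(1) h mem_parabolic_lcoset[OF assms(2,1)] by blast
next
  fix x assume "x \<in> ?S"
  then obtain t h where t: "t \<in> I" "t \<notin> J" "x = (t, h \<cdot> csub C t)" "h \<in> carrier G"
      and h: "\<And>j. j \<in> J \<Longrightarrow> h \<in> g \<cdot> csub C j"
    using mem_parabolic_lcoset[OF assms(2,1)] by blast
  have "h \<in> h \<cdot> csub C t" using G.lcos_self csub_subgroup t by blast
  then show "x \<in> ?R"
    using t h by (auto simp: residue_def elems_coset_incidence coset_flag_def)
qed

lemma corank_coset_flag:
  assumes "J \<subseteq> I"
  shows "corank (coset_incidence C) (coset_flag g J) = card (I - J)"
proof -
  have "card (coset_flag g J) = card J"
    unfolding coset_flag_def by (rule card_image) (simp add: inj_on_def)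
  then show ?thesis
    using card_Diff_subset[OF finite_subset[OF assms finite_types] assms]
    by (simp add: corank_def)
qed

lemma corank_one_cases:
  assumes "flag (coset_incidence C) F" "corank (coset_incidence C) F = 1"
  obtains g t where "g \<in> carrier G" "t \<in> I" "F = coset_flag g (I - {t})"
proof -
  obtain g J where g: "g \<in> carrier G" "J \<subseteq> I" "F = coset_flag g J"
    using flag_cases[OF assms(1)] by metis
  then obtain t where "I - J = {t}"
    using assms(2) corank_coset_flag[OF g(2)] by (metis card_1_singletonE)
  then have "t \<in> I" "J = I - {t}" using g(2) by auto
  then show thesis using that g by blast
qed

section \<open>Residual connectedness as generation of G_J by the larger parabolic types\<close>

abbreviation generated_by_larger :: "'t set \<Rightarrow> bool" where
  "generated_by_larger J \<equiv> parabolic C J \<subseteq> generate G (\<Union>t\<in>I - J. parabolic C (insert t J))"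

text \<open>Two cosets of the residue with the same representative h are incident. If x lies in the
  parabolic subgroup of type \<open>insert u J\<close>, then h G_u = (h x) G_u, so this coset links
  a coset of h to a coset of h x. A product of generators gives a concatenation of such
  links.\<close>

lemma connected_residueI:
  assumes g: "g \<in> carrier G" and J: "J \<subseteq> I" and gen: "generated_by_larger J"
  shows "connected_incidence_graph (residue (coset_incidence C) (coset_flag g J))"
proof -
  let ?R = "residue (coset_incidence C) (coset_flag g J)"
  let ?E = "{(u, v). u \<in> elems ?R \<and> v \<in> elems ?R \<and> inc ?R u v}\<^sup>*"
  note P = parabolic_subgroup[OF J]
  have step: "((s, h \<cdot> csub C s), (t, h \<cdot> csub C t)) \<in> ?E"
    if "s \<in> I - J" "t \<in> I - J" "h \<in> g \<cdot> parabolic C J" for s t h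
  proof -
    have "h \<in> carrier G" using that(3) mem_lcoset[OF P g] by blast
    then have "h \<in> h \<cdot> csub C s" "h \<in> h \<cdot> csub C t" using G.lcos_self csub_subgroup that by auto
    then have "inc ?R (s, h \<cdot> csub C s) (t, h \<cdot> csub C t)" by (auto simp: residue_def)
    moreover have "(s, h \<cdot> csub C s) \<in> elems ?R" "(t, h \<cdot> csub C t) \<in> elems ?R"
      using that unfolding elems_residue[OF g J] by blast+
    ultimately show ?thesis by blast
  qed
  have mult: "h \<otimes>\<^bsub>G\<^esub> x \<in> g \<cdot> parabolic C J" if "h \<in> g \<cdot> parabolic C J" "x \<in> parabolic C J" for h x
    using that lcoset_eq[OF P g that(1)] mem_lcoset[OF P g] by (auto simp: l_coset_def)
  have within: "((s, h \<cdot> csub C s), (t, (h \<otimes>\<^bsub>G\<^esub> x) \<cdot> csub C t)) \<in> ?E"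
    if u: "u \<in> I - J" "x \<in> parabolic C (insert u J)"
      and st: "s \<in> I - J" "t \<in> I - J" "h \<in> g \<cdot> parabolic C J" for s t u h x
  proof -
    have x: "x \<in> parabolic C J" "x \<in> csub C u" using u by (auto simp: parabolic_def)
    have h: "h \<in> carrier G" using st(3) mem_lcoset[OF P g] by blast
    have "h \<otimes>\<^bsub>G\<^esub> x \<in> h \<cdot> csub C u" using x(2) by (auto simp: l_coset_def)
    then have "h \<cdot> csub C u = (h \<otimes>\<^bsub>G\<^esub> x) \<cdot> csub C u"
      using lcoset_eq[OF csub_subgroup h] u by blast
    then show ?thesis
      using step[OF st(1) u(1) st(3)] step[OF u(1) st(2) mult[OF st(3) x(1)]] by (auto intro: rtrancl_trans)
  qed
  have sub: "generate G (\<Union>t\<in>I - J. parabolic C (insert t J)) \<subseteq> parabolic C J"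
    by (rule G.generate_subgroup_incl[OF _ P]) (auto simp: parabolic_def)
  have path: "((s, h \<cdot> csub C s), (t, (h \<otimes>\<^bsub>G\<^esub> x) \<cdot> csub C t)) \<in> ?E"
    if "x \<in> generate G (\<Union>t\<in>I - J. parabolic C (insert t J))"
      "s \<in> I - J" "t \<in> I - J" "h \<in> g \<cdot> parabolic C J" for x s t h
    using that
  proof (induction arbitrary: s t h rule: generate.induct)
    case one
    then show ?case using step[OF one] mem_lcoset[OF P g] by simp
  next
    case (incl x)
    then show ?case using within by blast
  next
    case (inv x)
    then obtain u where u: "u \<in> I - J" "x \<in> parabolic C (insert u J)" by blast
    then have "inv\<^bsub>G\<^esub> x \<in> parabolic C (insert u J)"
      using subgroup.m_inv_closed[OF parabolic_subgroup[of "insert u J"]] J by blast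
    then show ?case using within u(1) inv by blast
  next
    case (eng x y)
    have xy: "x \<in> parabolic C J" "y \<in> parabolic C J" using eng(1,2) sub by auto
    have "h \<otimes>\<^bsub>G\<^esub> (x \<otimes>\<^bsub>G\<^esub> y) = (h \<otimes>\<^bsub>G\<^esub> x) \<otimes>\<^bsub>G\<^esub> y"
      using xy eng(7) mem_lcoset[OF P g] by (simp add: parabolic_def G.m_assoc)
    \<comment> \<open>The second path keeps the type t at both ends, so it starts where the first
      one stops.\<close>
    then show ?case
      using eng.IH(1)[OF eng(5,6,7)] eng.IH(2)[OF eng(6,6) mult[OF eng(7) xy(1)]]
      by (auto intro: rtrancl_trans)
  qed
  show ?thesis
    unfolding connected_incidence_graph_def
  proof (intro ballI)
    fix x y assume "x \<in> elems ?R" "y \<in> elems ?R"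
    then obtain s h t k where x: "x = (s, h \<cdot> csub C s)" "s \<in> I - J" "h \<in> g \<cdot> parabolic C J"
      and y: "y = (t, k \<cdot> csub C t)" "t \<in> I - J" "k \<in> g \<cdot> parabolic C J"
      by (auto simp: elems_residue[OF g J])
    have hk: "h \<in> carrier G" "k \<in> carrier G" using x(3) y(3) mem_lcoset[OF P g] by auto
    have "inv\<^bsub>G\<^esub> h \<otimes>\<^bsub>G\<^esub> k \<in> parabolic C J"
      using y(3) lcoset_eq[OF P g x(3)] mem_lcoset[OF P hk(1)] by simp
    moreover have "h \<otimes>\<^bsub>G\<^esub> (inv\<^bsub>G\<^esub> h \<otimes>\<^bsub>G\<^esub> k) = k" using hk by (simp flip: G.m_assoc)
    ultimately show "(x, y) \<in> ?E"
      using path[OF subsetD[OF gen], of "inv\<^bsub>G\<^esub> h \<otimes>\<^bsub>G\<^esub> k", OF _ x(2) y(2) x(3)] x(1) y(1) by simp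
  qed
qed

text \<open>Let H be the generated subgroup. A path from G_s to x G_s shows that x G_s contains some
  h in H. Then x and h differ by an element of G_J and of G_s, that is, by a generator of H, so x is
  in H.\<close>

lemma generated_by_largerI:
  assumes J: "J \<subset> I"
    and con: "connected_incidence_graph (residue (coset_incidence C) (coset_flag \<one>\<^bsub>G\<^esub> J))"
  shows "generated_by_larger J"
proof
  let ?R = "residue (coset_incidence C) (coset_flag \<one>\<^bsub>G\<^esub> J)"
  let ?H = "generate G (\<Union>t\<in>I - J. parabolic C (insert t J))"
  have JI: "J \<subseteq> I" using J by blast
  note P = parabolic_subgroup[OF JI]
  have one: "\<one>\<^bsub>G\<^esub> \<cdot> parabolic C J = parabolic C J"
    using subgroup.subset[OF P] by (simp add: G.lcos_mult_one)
  note res = elems_residue[OF G.one_closed JI, unfolded one]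
  have HP: "?H \<subseteq> parabolic C J"
    by (rule G.generate_subgroup_incl[OF _ P]) (auto simp: parabolic_def)
  have larger: "k \<in> ?H" if "h \<in> ?H" "k \<in> parabolic C J" "u \<in> I - J" "k \<in> h \<cdot> csub C u" for h k u
  proof -
    have h: "h \<in> parabolic C J" "h \<in> carrier G" using that(1) HP by (auto simp: parabolic_def)
    have "inv\<^bsub>G\<^esub> h \<otimes>\<^bsub>G\<^esub> k \<in> parabolic C J"
      using subgroup.m_closed[OF P] subgroup.m_inv_closed[OF P] h that(2) by blast
    moreover have "inv\<^bsub>G\<^esub> h \<otimes>\<^bsub>G\<^esub> k \<in> csub C u"
      using that mem_lcoset[OF csub_subgroup h(2)] by blast
    ultimately have "inv\<^bsub>G\<^esub> h \<otimes>\<^bsub>G\<^esub> k \<in> ?H"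
      using that(3) by (intro generate.incl) (auto simp: parabolic_def)
    then have "h \<otimes>\<^bsub>G\<^esub> (inv\<^bsub>G\<^esub> h \<otimes>\<^bsub>G\<^esub> k) \<in> ?H" using that(1) by (rule generate.eng[rotated])
    then show ?thesis using h(2) that(2) by (simp add: parabolic_def flip: G.m_assoc)
  qed
  fix x assume x: "x \<in> parabolic C J"
  obtain s where s: "s \<in> I - J" using J by blast
  have xc: "x \<in> carrier G" using x by (simp add: parabolic_def)
  have "((s, \<one>\<^bsub>G\<^esub> \<cdot> csub C s), (s, x \<cdot> csub C s)) \<in>
      {(u, v). u \<in> elems ?R \<and> v \<in> elems ?R \<and> inc ?R u v}\<^sup>*"
    using con s x subgroup.one_closed[OF P] unfolding connected_incidence_graph_def res by blast
  \<comment> \<open>All cosets on a path starting at a subgroup meet \<open>H\<close>.\<close>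
  then have "(snd (s, x \<cdot> csub C s)) \<inter> ?H \<noteq> {}"
  proof (induction rule: rtrancl_induct)
    case base
    have "\<one>\<^bsub>G\<^esub> \<in> \<one>\<^bsub>G\<^esub> \<cdot> csub C s" using G.lcos_self csub_subgroup s by blast
    then show ?case using generate.one[of G] by auto
  next
    case (step y z)
    then obtain u h where y: "y = (u, h \<cdot> csub C u)" "u \<in> I - J" "h \<in> parabolic C J"
      by (auto simp: res)
    obtain v k where z: "z = (v, k \<cdot> csub C v)" "v \<in> I - J" "k \<in> parabolic C J"
      using step by (auto simp: res)
    obtain m where m: "m \<in> h \<cdot> csub C u" "m \<in> ?H" using step.IH y by auto
    have c: "h \<in> carrier G" "k \<in> carrier G" using y z by (auto simp: parabolic_def)
    have "h \<cdot> csub C u \<inter> k \<cdot> csub C v \<noteq> {}"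
      using step y z by (simp add: residue_def)
    moreover have "h \<in> h \<cdot> csub C u" "k \<in> k \<cdot> csub C v"
      using G.lcos_self[OF _ csub_subgroup] y z c by blast+
    moreover have "\<And>j. j \<in> J \<Longrightarrow> h \<in> \<one>\<^bsub>G\<^esub> \<cdot> csub C j \<and> k \<in> \<one>\<^bsub>G\<^esub> \<cdot> csub C j \<and> \<one>\<^bsub>G\<^esub> \<in> \<one>\<^bsub>G\<^esub> \<cdot> csub C j"
      using y z c mem_parabolic_lcoset[OF JI G.one_closed] subgroup.one_closed[OF P] unfolding one by blast
    \<comment> \<open>Two incident cosets of the residue meet inside G_J: together with the G_j for
      j in J they are pairwise incident. The element \<open>l\<close> found here carries membership
      in H from one coset to the next.\<close>
    ultimately have "\<exists>z\<in>carrier G. \<forall>(i, g)\<in>{(u, h), (v, k)} \<union> J \<times> {\<one>\<^bsub>G\<^esub>}. z \<in> g \<cdot> csub C i"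
      using y z c JI by (intro common_element) blast+
    then obtain l where l: "l \<in> carrier G" "l \<in> h \<cdot> csub C u" "l \<in> k \<cdot> csub C v"
        "\<And>j. j \<in> J \<Longrightarrow> l \<in> \<one>\<^bsub>G\<^esub> \<cdot> csub C j" by auto
    have "l \<in> parabolic C J" using l mem_parabolic_lcoset[OF JI G.one_closed] unfolding one by blast
    moreover have "l \<in> m \<cdot> csub C u" using l(2) lcoset_eq[OF csub_subgroup c(1) m(1)] y(2) by blast
    ultimately have "l \<in> ?H" using larger[OF m(2)] y(2) by blast
    then show ?case using l(3) z(1) by auto
  qed
  then obtain h where h: "h \<in> ?H" "h \<in> x \<cdot> csub C s" by auto
  have "x \<cdot> csub C s = h \<cdot> csub C s" using lcoset_eq[OF csub_subgroup xc h(2)] s by blast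
  then have "x \<in> h \<cdot> csub C s" using G.lcos_self[OF xc csub_subgroup] s by blast
  then show "x \<in> ?H" using larger[OF h(1) x s] by blast
qed

text \<open>One direction tests only the flags of subgroups G_j; for the other, the generation
  condition on G_J handles all translates \<open>coset_flag g J\<close> at once.\<close>

theorem residually_connected_iff:
  "residually_connected (coset_incidence C) \<longleftrightarrow>
     (\<forall>J\<subseteq>I. 2 \<le> card (I - J) \<longrightarrow> generated_by_larger J)"
proof
  assume rc: "residually_connected (coset_incidence C)"
  show "\<forall>J\<subseteq>I. 2 \<le> card (I - J) \<longrightarrow> generated_by_larger J"
  proof (intro allI impI)
    fix J assume J: "J \<subseteq> I" "2 \<le> card (I - J)"
    then have "J \<subset> I" by auto
    then show "generated_by_larger J"
      using rc J coset_flag_flag(1)[OF G.one_closed J(1)] corank_coset_flag[OF J(1)]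
      by (intro generated_by_largerI) (auto simp: residually_connected_def)
  qed
next
  assume gen: "\<forall>J\<subseteq>I. 2 \<le> card (I - J) \<longrightarrow> generated_by_larger J"
  show "residually_connected (coset_incidence C)"
    unfolding residually_connected_def
  proof (intro conjI is_geometry allI impI, elim conjE)
    fix F assume F: "flag (coset_incidence C) F" "2 \<le> corank (coset_incidence C) F"
    obtain g J where g: "g \<in> carrier G" "J \<subseteq> I" "F = coset_flag g J" using flag_cases[OF F(1)] by metis
    then show "connected_incidence_graph (residue (coset_incidence C) F)"
      using connected_residueI[OF g(1,2)] gen F(2) corank_coset_flag[OF g(2)] by auto
  qed
qed

section \<open>Firmness and thinness in terms of the parabolic subgroups of corank one\<close>

theorem firm_iff:
  "firm (coset_incidence C) \<longleftrightarrow> (\<forall>t\<in>I. \<not> parabolic C (I - {t}) \<subseteq> csub C t)"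
proof
  assume firm: "firm (coset_incidence C)"
  show "\<forall>t\<in>I. \<not> parabolic C (I - {t}) \<subseteq> csub C t"
  proof (intro ballI notI)
    fix t assume t: "t \<in> I" "parabolic C (I - {t}) \<subseteq> csub C t"
    let ?J = "I - {t}"
    have J: "?J \<subseteq> I" "I - ?J = {t}" using t by auto
    obtain x y where xy: "x \<in> elems (residue (coset_incidence C) (coset_flag \<one>\<^bsub>G\<^esub> ?J))"
        "y \<in> elems (residue (coset_incidence C) (coset_flag \<one>\<^bsub>G\<^esub> ?J))" "x \<noteq> y"
      using firm coset_flag_flag(1)[OF G.one_closed J(1)] corank_coset_flag[OF J(1), of "\<one>\<^bsub>G\<^esub>"] J(2)
      unfolding firm_def by fastforce
    \<comment> \<open>All elements of the residue have type t and a representative in G_J, so they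
      coincide if G_J lies in G_t.\<close>
    have "h \<cdot> csub C t = \<one>\<^bsub>G\<^esub> \<cdot> csub C t" if "h \<in> \<one>\<^bsub>G\<^esub> \<cdot> parabolic C ?J" for h
    proof -
      have "h \<in> \<one>\<^bsub>G\<^esub> \<cdot> csub C t" using that t(2) by (auto simp: l_coset_def)
      then show ?thesis using lcoset_eq[OF csub_subgroup[OF t(1)] G.one_closed] by simp
    qed
    then show False using xy unfolding elems_residue[OF G.one_closed J(1)] J(2) by auto
  qed
next
  assume np: "\<forall>t\<in>I. \<not> parabolic C (I - {t}) \<subseteq> csub C t"
  show "firm (coset_incidence C)"
    unfolding firm_def
  proof (intro conjI is_geometry allI impI, elim conjE)
    fix F assume F: "flag (coset_incidence C) F" "corank (coset_incidence C) F = 1"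
    obtain g t where g: "g \<in> carrier G" "t \<in> I" "F = coset_flag g (I - {t})"
      using corank_one_cases[OF F] .
    obtain x where x: "x \<in> parabolic C (I - {t})" "x \<notin> csub C t" using np g(2) by blast
    have xc: "x \<in> carrier G" using x(1) by (simp add: parabolic_def)
    \<comment> \<open>The elements g and g x both represent elements of the residue, and these are
      distinct since x is not in G_t.\<close>
    have "g \<otimes>\<^bsub>G\<^esub> x \<notin> g \<cdot> csub C t"
      using mem_lcoset[OF csub_subgroup[OF g(2)] g(1)] x(2) g(1) xc by (simp flip: G.m_assoc)
    then have "g \<cdot> csub C t \<noteq> (g \<otimes>\<^bsub>G\<^esub> x) \<cdot> csub C t"
      using G.lcos_self[OF G.m_closed[OF g(1) xc] csub_subgroup[OF g(2)]] by auto
    moreover have "g \<in> g \<cdot> parabolic C (I - {t})"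
      by (rule G.lcos_self[OF g(1) parabolic_subgroup]) blast
    moreover have "g \<otimes>\<^bsub>G\<^esub> x \<in> g \<cdot> parabolic C (I - {t})" using x(1) by (auto simp: l_coset_def)
    ultimately show "\<exists>x\<in>elems (residue (coset_incidence C) F). \<exists>y\<in>elems (residue (coset_incidence C) F). x \<noteq> y"
      using elems_residue[OF g(1) Diff_subset, of "{t}"] g(2,3) by blast
  qed
qed

text \<open>The intersection of \<open>parabolic C (I - {t})\<close> with G_t is the Borel subgroup.
  As this is trivial, distinct elements of the parabolic subgroup represent distinct cosets.\<close>

lemma card_residue:
  assumes g: "g \<in> carrier G" and t: "t \<in> I" and borel: "borel C = {\<one>\<^bsub>G\<^esub>}"
  shows "card (elems (residue (coset_incidence C) (coset_flag g (I - {t})))) = card (parabolic C (I - {t}))"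
proof -
  let ?P = "parabolic C (I - {t})"
  let ?f = "\<lambda>x. (t, (g \<otimes>\<^bsub>G\<^esub> x) \<cdot> csub C t)"
  have P: "subgroup ?P G" by (rule parabolic_subgroup) blast
  have carr: "x \<in> carrier G" if "x \<in> ?P" for x using that by (simp add: parabolic_def)
  have "I - (I - {t}) = {t}" using t by blast
  then have "elems (residue (coset_incidence C) (coset_flag g (I - {t}))) = ?f ` ?P"
    unfolding elems_residue[OF g Diff_subset] by (auto simp: l_coset_def)
  moreover have "inj_on ?f ?P"
  proof (rule inj_onI)
    fix x y assume xy: "x \<in> ?P" "y \<in> ?P" "?f x = ?f y"
    have "g \<otimes>\<^bsub>G\<^esub> y \<in> (g \<otimes>\<^bsub>G\<^esub> x) \<cdot> csub C t"
      using G.lcos_self[OF G.m_closed[OF g carr[OF xy(2)]] csub_subgroup[OF t]] xy(3) by simp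
    then have "inv\<^bsub>G\<^esub> (g \<otimes>\<^bsub>G\<^esub> x) \<otimes>\<^bsub>G\<^esub> (g \<otimes>\<^bsub>G\<^esub> y) \<in> csub C t"
      using mem_lcoset[OF csub_subgroup[OF t]] g carr xy by simp
    moreover have "inv\<^bsub>G\<^esub> g \<otimes>\<^bsub>G\<^esub> (g \<otimes>\<^bsub>G\<^esub> y) = y"
      using g carr xy(2) by (simp flip: G.m_assoc)
    then have "inv\<^bsub>G\<^esub> (g \<otimes>\<^bsub>G\<^esub> x) \<otimes>\<^bsub>G\<^esub> (g \<otimes>\<^bsub>G\<^esub> y) = inv\<^bsub>G\<^esub> x \<otimes>\<^bsub>G\<^esub> y"
      using g carr xy(1,2) by (simp add: G.inv_mult_group G.m_assoc)
    moreover have "inv\<^bsub>G\<^esub> x \<otimes>\<^bsub>G\<^esub> y \<in> ?P"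
      using subgroup.m_closed[OF P] subgroup.m_inv_closed[OF P] xy by blast
    ultimately have "inv\<^bsub>G\<^esub> x \<otimes>\<^bsub>G\<^esub> y \<in> borel C" by (auto simp: borel_def parabolic_def)
    then have "inv\<^bsub>G\<^esub> x \<otimes>\<^bsub>G\<^esub> y = \<one>\<^bsub>G\<^esub>" using borel by simp
    then show "x = y" using carr xy by (metis G.inv_closed G.inv_equality G.inv_inv G.inv_comm)
  qed
  ultimately show ?thesis by (simp add: card_image)
qed

theorem thin_iff:
  assumes "borel C = {\<one>\<^bsub>G\<^esub>}"
  shows "thin (coset_incidence C) \<longleftrightarrow> (\<forall>t\<in>I. card (parabolic C (I - {t})) = 2)"
proof
  assume thin: "thin (coset_incidence C)"
  show "\<forall>t\<in>I. card (parabolic C (I - {t})) = 2"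
  proof
    fix t assume t: "t \<in> I"
    have "I - (I - {t}) = {t}" using t by blast
    then have "corank (coset_incidence C) (coset_flag \<one>\<^bsub>G\<^esub> (I - {t})) = 1"
      using corank_coset_flag[OF Diff_subset, of "\<one>\<^bsub>G\<^esub>" "{t}"] by simp
    then show "card (parabolic C (I - {t})) = 2"
      using thin coset_flag_flag(1)[OF G.one_closed Diff_subset] card_residue[OF G.one_closed t assms]
      by (auto simp: thin_def)
  qed
next
  assume two: "\<forall>t\<in>I. card (parabolic C (I - {t})) = 2"
  show "thin (coset_incidence C)"
    unfolding thin_def
  proof (intro conjI is_geometry allI impI, elim conjE)
    fix F assume "flag (coset_incidence C) F" "corank (coset_incidence C) F = 1"
    then obtain g t where "g \<in> carrier G" "t \<in> I" "F = coset_flag g (I - {t})"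
      by (rule corank_one_cases)
    then show "card (elems (residue (coset_incidence C) F)) = 2"
      using card_residue[OF _ _ assms] two by simp
  qed
qed

end

section \<open>Wreath products of coset incidence systems\<close>

locale wreath_coset_system =
  A: coset_incidence_system \<alpha> + B: coset_incidence_system \<beta>
  for \<alpha> :: "('a, 'i) coset_system" and \<beta> :: "('b, 'j) coset_system" +
  fixes \<Omega> :: "'w set" and \<phi> :: "'b \<Rightarrow> 'w \<Rightarrow> 'w" and rep :: "('i \<times> 'w) set \<Rightarrow> 'i \<times> 'w"
  assumes finite_points: "finite \<Omega>"
    and action: "group_action (cgroup \<beta>) \<Omega> \<phi>"
    and representatives: "admissible_representatives \<alpha> \<beta> \<Omega> \<phi> rep"
begin

abbreviation W where "W \<equiv> wreath_system \<alpha> \<beta> \<Omega> \<phi> rep"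
abbreviation K where "K \<equiv> type_orbits \<alpha> \<beta> \<Omega> \<phi>"
abbreviation tact where "tact \<equiv> type_action \<alpha> \<Omega> \<phi>"
abbreviation rep_orbit where "rep_orbit H L \<equiv> sub_orbit (cgroup \<beta>) H tact (rep L)"

sublocale act: group_action "cgroup \<beta>" \<Omega> \<phi>
  by (rule action)

sublocale tact: group_action "cgroup \<beta>" "ctypes \<alpha> \<times> \<Omega>" tact
  by (rule type_action_group_action[OF A.is_coset_system B.is_coset_system finite_points action])

sublocale W: coset_incidence_system W
  by (standard) (rule wreath_system_is_coset_system[OF A.is_coset_system B.is_coset_system finite_points action representatives])

lemma act_closed [simp]: "b \<in> carrier (cgroup \<beta>) \<Longrightarrow> w \<in> \<Omega> \<Longrightarrow> \<phi> b w \<in> \<Omega>"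
  using act.element_image by blast

lemma act_inv [simp]:
  assumes "b \<in> carrier (cgroup \<beta>)" "w \<in> \<Omega>"
  shows "\<phi> (inv\<^bsub>cgroup \<beta>\<^esub> b) (\<phi> b w) = w" "\<phi> b (\<phi> (inv\<^bsub>cgroup \<beta>\<^esub> b) w) = w"
  using act.orbit_sym_aux[OF assms refl] act.orbit_sym_aux[OF B.G.inv_closed[OF assms(1)] assms(2) refl] assms(1)
  by simp_all

lemma act_one [simp]: "w \<in> \<Omega> \<Longrightarrow> \<phi> \<one>\<^bsub>cgroup \<beta>\<^esub> w = w"
  by (metis act.id_eq_one restrict_apply')

lemma tact_apply [simp]: "j \<in> ctypes \<alpha> \<Longrightarrow> l \<in> \<Omega> \<Longrightarrow> tact b (j, l) = (j, \<phi> b l)"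
  by (simp add: type_action_def)

section \<open>Group, types and subgroups of the wreath product\<close>

lemma ctypes_wreath [simp]: "ctypes W = K <+> ctypes \<beta>"
  by (simp add: wreath_system_def Let_def)

lemma carrier_wreath [simp]: "carrier (cgroup W) = (\<Omega> \<rightarrow>\<^sub>E carrier (cgroup \<alpha>)) \<times> carrier (cgroup \<beta>)"
  by (simp add: wreath_system_def Let_def wreath_group_def semidirect_def)

lemma one_wreath [simp]: "\<one>\<^bsub>cgroup W\<^esub> = (\<lambda>w\<in>\<Omega>. \<one>\<^bsub>cgroup \<alpha>\<^esub>, \<one>\<^bsub>cgroup \<beta>\<^esub>)"
  by (simp add: wreath_system_def Let_def wreath_group_def semidirect_def)

lemma mult_wreath [simp]:
  "(a, b) \<otimes>\<^bsub>cgroup W\<^esub> (c, d) =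
     (\<lambda>w\<in>\<Omega>. a w \<otimes>\<^bsub>cgroup \<alpha>\<^esub> c (\<phi> (inv\<^bsub>cgroup \<beta>\<^esub> b) w), b \<otimes>\<^bsub>cgroup \<beta>\<^esub> d)"
  by (auto simp: wreath_system_def Let_def wreath_group_def semidirect_def permute_coords_def fun_eq_iff)

text \<open>Each subgroup of the wreath system is the product of \<open>top_part x\<close> with the
  subgroup of the base group that satisfies the conditions imposed at the types in
  \<open>fixed_types x\<close>. This form covers both kinds of types at once.\<close>

definition fixed_types :: "('i \<times> 'w) set + 'j \<Rightarrow> ('i \<times> 'w) set" where
  "fixed_types x = (case x of Inl L \<Rightarrow> L | Inr i \<Rightarrow> (\<Union>L\<in>K. L - rep_orbit (csub \<beta> i) L))"

definition top_part :: "('i \<times> 'w) set + 'j \<Rightarrow> 'b set" where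
  "top_part x = (case x of Inl L \<Rightarrow> carrier (cgroup \<beta>) | Inr i \<Rightarrow> csub \<beta> i)"

lemma fixed_types_simps [simp]:
  "fixed_types (Inl L) = L" "fixed_types (Inr i) = (\<Union>L\<in>K. L - rep_orbit (csub \<beta> i) L)"
  by (simp_all add: fixed_types_def)

lemma top_part_simps [simp]:
  "top_part (Inl L) = carrier (cgroup \<beta>)" "top_part (Inr i) = csub \<beta> i"
  by (simp_all add: top_part_def)

lemma csub_wreath:
  "(n, h) \<in> csub W x \<longleftrightarrow>
     n \<in> \<Omega> \<rightarrow>\<^sub>E carrier (cgroup \<alpha>) \<and> h \<in> top_part x \<and> (\<forall>(j, l)\<in>fixed_types x. n l \<in> csub \<alpha> j)"
proof -
  have "n \<in> parabolic (product_system \<alpha> \<Omega>) S \<longleftrightarrow>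
      n \<in> \<Omega> \<rightarrow>\<^sub>E carrier (cgroup \<alpha>) \<and> (\<forall>(j, l)\<in>S. n l \<in> csub \<alpha> j)" for S
    by (auto simp: parabolic_def product_system_def split_beta)
  then show ?thesis
    by (cases x) (auto simp: wreath_system_def Let_def fixed_types_def)
qed

section \<open>Orbits of B on the types of the product system\<close>

lemma orbit_subset: "L \<in> K \<Longrightarrow> L \<subseteq> ctypes \<alpha> \<times> \<Omega>"
  using tact.orbits_coverture by (auto simp: type_orbits_def)

lemma orbit_cover: "e \<in> ctypes \<alpha> \<times> \<Omega> \<Longrightarrow> \<exists>L\<in>K. e \<in> L"
  using tact.orbits_coverture by (auto simp: type_orbits_def)

lemma orbit_unique: "L \<in> K \<Longrightarrow> M \<in> K \<Longrightarrow> e \<in> L \<Longrightarrow> e \<in> M \<Longrightarrow> L = M"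
  using tact.disjoint_union unfolding type_orbits_def by blast

lemma rep_in_orbit: "L \<in> K \<Longrightarrow> rep L \<in> L"
  using representatives by (simp add: admissible_representatives_def)

lemma rep_in_types: "L \<in> K \<Longrightarrow> rep L \<in> ctypes \<alpha> \<times> \<Omega>"
  using rep_in_orbit orbit_subset by blast

lemma mem_rep_orbit: "e \<in> rep_orbit H L \<longleftrightarrow> (\<exists>h\<in>H. e = tact h (rep L))"
  by (auto simp: sub_orbit_def orbit_def)

lemma rep_orbit_mono: "H \<subseteq> H' \<Longrightarrow> rep_orbit H L \<subseteq> rep_orbit H' L"
  unfolding subset_iff mem_rep_orbit by blast

text \<open>Both sides are B-orbits containing \<open>rep L\<close>.\<close>

lemma rep_orbit_carrier:
  assumes "L \<in> K"
  shows "rep_orbit (carrier (cgroup \<beta>)) L = L"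
proof -
  have "orbit (cgroup \<beta>) tact (rep L) \<in> K"
    unfolding type_orbits_def orbits_def by (intro CollectI exI conjI) (rule refl, rule rep_in_types[OF assms])
  moreover have "rep L = tact \<one>\<^bsub>cgroup \<beta>\<^esub> (rep L)"
    using rep_in_types[OF assms] by (cases "rep L") simp
  then have "rep L \<in> orbit (cgroup \<beta>) tact (rep L)" unfolding orbit_def by blast
  ultimately show ?thesis
    using orbit_unique[OF _ assms _ rep_in_orbit[OF assms]] by (simp add: sub_orbit_def)
qed

section \<open>Cosets and flag-transitivity of the wreath product\<close>

lemma fixed_types_subset:
  assumes "x \<in> ctypes W"
  shows "fixed_types x \<subseteq> ctypes \<alpha> \<times> \<Omega>"
proof (cases x)
  case (Inl L)
  then show ?thesis using assms orbit_subset[of L] by auto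
next
  case (Inr i)
  then show ?thesis unfolding Inr fixed_types_simps using orbit_subset by blast
qed

text \<open>Multiplication by (a, b) moves coordinate l of n to coordinate \<phi> b l, so a
  condition on n at l becomes a coset condition on c at \<phi> b l. The conditions on c and on d are
  independent of each other.\<close>

lemma mem_wreath_lcoset:
  assumes x: "x \<in> ctypes W" and a: "a \<in> \<Omega> \<rightarrow>\<^sub>E carrier (cgroup \<alpha>)" and b: "b \<in> carrier (cgroup \<beta>)"
  shows "(c, d) \<in> (a, b) <#\<^bsub>cgroup W\<^esub> csub W x \<longleftrightarrow>
    c \<in> \<Omega> \<rightarrow>\<^sub>E carrier (cgroup \<alpha>) \<and> d \<in> b <#\<^bsub>cgroup \<beta>\<^esub> top_part x \<and>
    (\<forall>(j, l)\<in>fixed_types x. c (\<phi> b l) \<in> a (\<phi> b l) <#\<^bsub>cgroup \<alpha>\<^esub> csub \<alpha> j)" (is "?L \<longleftrightarrow> ?R")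
proof
  assume ?L
  then obtain n h where n: "(n, h) \<in> csub W x" "(c, d) = (a, b) \<otimes>\<^bsub>cgroup W\<^esub> (n, h)"
    unfolding l_coset_def by auto
  have "h \<in> top_part x" using n(1) by (simp add: csub_wreath)
  then have "d \<in> b <#\<^bsub>cgroup \<beta>\<^esub> top_part x" using n(2) by (auto simp: l_coset_def)
  moreover have "(c, d) \<in> carrier (cgroup W)"
    unfolding n(2) using n(1) a b subgroup.mem_carrier[OF W.csub_subgroup[OF x]]
    by (intro W.G.m_closed) auto
  moreover have "c (\<phi> b l) \<in> a (\<phi> b l) <#\<^bsub>cgroup \<alpha>\<^esub> csub \<alpha> j" if "(j, l) \<in> fixed_types x" for j l
  proof -
    have l: "l \<in> \<Omega>" using that fixed_types_subset[OF x] by blast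
    have "c (\<phi> b l) = a (\<phi> b l) \<otimes>\<^bsub>cgroup \<alpha>\<^esub> n l" using n(2) l b by simp
    then show ?thesis using n(1) that by (auto simp: l_coset_def csub_wreath)
  qed
  ultimately show ?R by auto
next
  assume R: ?R
  then obtain h where h: "h \<in> top_part x" "d = b \<otimes>\<^bsub>cgroup \<beta>\<^esub> h" by (auto simp: l_coset_def)
  \<comment> \<open>Obtained by solving (c, d) = (a, b) (n, h) for n at the coordinate l.\<close>
  define n where "n = (\<lambda>l\<in>\<Omega>. inv\<^bsub>cgroup \<alpha>\<^esub> a (\<phi> b l) \<otimes>\<^bsub>cgroup \<alpha>\<^esub> c (\<phi> b l))"
  have carr: "a w \<in> carrier (cgroup \<alpha>)" "c w \<in> carrier (cgroup \<alpha>)" if "w \<in> \<Omega>" for w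
    using R a that by auto
  have "n l \<in> csub \<alpha> j" if "(j, l) \<in> fixed_types x" for j l
  proof -
    have jl: "j \<in> ctypes \<alpha>" "l \<in> \<Omega>" using that fixed_types_subset[OF x] by auto
    then show ?thesis
      using R that A.mem_lcoset[OF A.csub_subgroup[OF jl(1)] carr(1)[OF act_closed[OF b jl(2)]]]
      by (auto simp: n_def)
  qed
  moreover have "n \<in> \<Omega> \<rightarrow>\<^sub>E carrier (cgroup \<alpha>)" using carr b by (auto simp: n_def)
  ultimately have "(n, h) \<in> csub W x" using h(1) by (auto simp: csub_wreath)
  moreover have "c w = (\<lambda>w\<in>\<Omega>. a w \<otimes>\<^bsub>cgroup \<alpha>\<^esub> n (\<phi> (inv\<^bsub>cgroup \<beta>\<^esub> b) w)) w" for w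
  proof (cases "w \<in> \<Omega>")
    case True
    then have "c w = a w \<otimes>\<^bsub>cgroup \<alpha>\<^esub> (inv\<^bsub>cgroup \<alpha>\<^esub> a w \<otimes>\<^bsub>cgroup \<alpha>\<^esub> c w)"
      using carr by (simp flip: A.G.m_assoc)
    then show ?thesis using True b by (simp add: n_def)
  next
    case False
    \<comment> \<open>Off \<Omega> both sides are \<open>undefined\<close>.\<close>
    then show ?thesis using R by (auto simp: PiE_iff extensional_def)
  qed
  then have "(c, d) = (a, b) \<otimes>\<^bsub>cgroup W\<^esub> (n, h)" using h(2) by (simp add: fun_eq_iff)
  ultimately show ?L unfolding l_coset_def by blast
qed

text \<open>The cosets of \<open>\<alpha>\<close> that a flag prescribes at a fixed coordinate form a flag themselves.\<close>

lemma wreath_flag_transitive: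
  assumes "flag_transitive \<alpha>" "flag_transitive \<beta>"
  shows "flag_transitive W"
proof (rule W.flag_transitiveI)
  interpret A: flag_transitive_system \<alpha> by standard (rule assms)
  interpret B: flag_transitive_system \<beta> by standard (rule assms)
  fix T
  assume T: "T \<subseteq> ctypes W \<times> carrier (cgroup W)"
    and meet: "\<And>x g y h. (x, g) \<in> T \<Longrightarrow> (y, h) \<in> T \<Longrightarrow>
      (g <#\<^bsub>cgroup W\<^esub> csub W x) \<inter> (h <#\<^bsub>cgroup W\<^esub> csub W y) \<noteq> {}"
  have inT: "x \<in> ctypes W" "a \<in> \<Omega> \<rightarrow>\<^sub>E carrier (cgroup \<alpha>)" "b \<in> carrier (cgroup \<beta>)"
    if "(x, (a, b)) \<in> T" for x a b
    using that T unfolding carrier_wreath by blast+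
  have meet': "\<exists>c d. d \<in> b <#\<^bsub>cgroup \<beta>\<^esub> top_part x \<and> d \<in> b' <#\<^bsub>cgroup \<beta>\<^esub> top_part y \<and>
      (\<forall>(j, l)\<in>fixed_types x. c (\<phi> b l) \<in> a (\<phi> b l) <#\<^bsub>cgroup \<alpha>\<^esub> csub \<alpha> j) \<and>
      (\<forall>(j, l)\<in>fixed_types y. c (\<phi> b' l) \<in> a' (\<phi> b' l) <#\<^bsub>cgroup \<alpha>\<^esub> csub \<alpha> j)"
    if m: "(x, (a, b)) \<in> T" "(y, (a', b')) \<in> T" for x a b y a' b'
  proof -
    obtain c d where cd: "(c, d) \<in> (a, b) <#\<^bsub>cgroup W\<^esub> csub W x" "(c, d) \<in> (a', b') <#\<^bsub>cgroup W\<^esub> csub W y"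
      using meet[OF m] by auto
    show ?thesis
      using cd(1)[unfolded mem_wreath_lcoset[OF inT[OF m(1)]]]
        cd(2)[unfolded mem_wreath_lcoset[OF inT[OF m(2)]]] by blast
  qed
  \<comment> \<open>Only types from \<beta> restrict the component in B; for an orbit L the top part
    is all of B.\<close>
  define TB where "TB = {(i, b). \<exists>a. (Inr i, (a, b)) \<in> T}"
  have "\<exists>d\<in>carrier (cgroup \<beta>). \<forall>(i, b)\<in>TB. d \<in> b <#\<^bsub>cgroup \<beta>\<^esub> csub \<beta> i"
  proof (rule B.common_element)
    show "TB \<subseteq> ctypes \<beta> \<times> carrier (cgroup \<beta>)" using inT(1,3)[of "Inr _"] by (auto simp: TB_def)
    fix i b i' b' assume "(i, b) \<in> TB" "(i', b') \<in> TB"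
    then obtain a a' where "(Inr i, (a, b)) \<in> T" "(Inr i', (a', b')) \<in> T"
      unfolding TB_def by blast
    from meet'[OF this] show "(b <#\<^bsub>cgroup \<beta>\<^esub> csub \<beta> i) \<inter> (b' <#\<^bsub>cgroup \<beta>\<^esub> csub \<beta> i') \<noteq> {}"
      unfolding top_part_simps by blast
  qed
  then obtain d where d: "d \<in> carrier (cgroup \<beta>)"
    "\<And>i a b. (Inr i, (a, b)) \<in> T \<Longrightarrow> d \<in> b <#\<^bsub>cgroup \<beta>\<^esub> csub \<beta> i"
    unfolding TB_def by blast
  \<comment> \<open>\<open>Q w z\<close> says that z is a possible value at coordinate w for a
    common element of all cosets in \<open>T\<close>. A coset of (a, b) is restricted at w by those
    of its fixed types (j, l) with \<phi> b l = w.\<close>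
  define Q where "Q w z \<longleftrightarrow> z \<in> carrier (cgroup \<alpha>) \<and> (\<forall>x a b j l. (x, (a, b)) \<in> T \<longrightarrow>
    (j, l) \<in> fixed_types x \<longrightarrow> \<phi> b l = w \<longrightarrow> z \<in> a w <#\<^bsub>cgroup \<alpha>\<^esub> csub \<alpha> j)" for w z
  have "\<exists>z. Q w z" if w: "w \<in> \<Omega>" for w
  proof -
    define TA where "TA = {(j, a w) | j a. \<exists>x b l. (x, (a, b)) \<in> T \<and> (j, l) \<in> fixed_types x \<and> \<phi> b l = w}"
    have "\<exists>z\<in>carrier (cgroup \<alpha>). \<forall>(j, g)\<in>TA. z \<in> g <#\<^bsub>cgroup \<alpha>\<^esub> csub \<alpha> j"
    proof (rule A.common_element)
      show "TA \<subseteq> ctypes \<alpha> \<times> carrier (cgroup \<alpha>)"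
      proof
        fix p assume "p \<in> TA"
        then obtain x a b j l where p: "p = (j, a w)" "(x, (a, b)) \<in> T" "(j, l) \<in> fixed_types x"
          unfolding TA_def by blast
        then show "p \<in> ctypes \<alpha> \<times> carrier (cgroup \<alpha>)"
          using inT[OF p(2)] fixed_types_subset[of x] w by blast
      qed
      fix j g j' g' assume "(j, g) \<in> TA" "(j', g') \<in> TA"
      then obtain x a b l x' a' b' l' where
        p: "(x, (a, b)) \<in> T" "(j, l) \<in> fixed_types x" "\<phi> b l = w" "g = a w"
        and q: "(x', (a', b')) \<in> T" "(j', l') \<in> fixed_types x'" "\<phi> b' l' = w" "g' = a' w"
        unfolding TA_def by blast
      obtain c where "c (\<phi> b l) \<in> a (\<phi> b l) <#\<^bsub>cgroup \<alpha>\<^esub> csub \<alpha> j"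
          "c (\<phi> b' l') \<in> a' (\<phi> b' l') <#\<^bsub>cgroup \<alpha>\<^esub> csub \<alpha> j'"
        using meet'[OF p(1) q(1)] p(2) q(2) by fast
      then show "(g <#\<^bsub>cgroup \<alpha>\<^esub> csub \<alpha> j) \<inter> (g' <#\<^bsub>cgroup \<alpha>\<^esub> csub \<alpha> j') \<noteq> {}"
        unfolding p(3) q(3) p(4) q(4) by blast
    qed
    then obtain z where z: "z \<in> carrier (cgroup \<alpha>)" "\<And>j g. (j, g) \<in> TA \<Longrightarrow> z \<in> g <#\<^bsub>cgroup \<alpha>\<^esub> csub \<alpha> j"
      by blast
    have "z \<in> a w <#\<^bsub>cgroup \<alpha>\<^esub> csub \<alpha> j"
      if "(x, (a, b)) \<in> T" "(j, l) \<in> fixed_types x" "\<phi> b l = w" for x a b j l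
      by (rule z(2)) (use that in \<open>auto simp: TA_def\<close>)
    then have "Q w z" using z(1) unfolding Q_def by blast
    then show ?thesis ..
  qed
  then have "\<forall>w\<in>\<Omega>. \<exists>z. Q w z" by blast
  from bchoice[OF this] obtain c where "\<forall>w\<in>\<Omega>. Q w (c w)" by blast
  then have c: "\<And>w. w \<in> \<Omega> \<Longrightarrow> c w \<in> carrier (cgroup \<alpha>)"
    "\<And>x a b j l. (x, (a, b)) \<in> T \<Longrightarrow> (j, l) \<in> fixed_types x \<Longrightarrow> \<phi> b l \<in> \<Omega> \<Longrightarrow>
      c (\<phi> b l) \<in> a (\<phi> b l) <#\<^bsub>cgroup \<alpha>\<^esub> csub \<alpha> j"
    unfolding Q_def by blast+
  \<comment> \<open>The values c w, chosen separately for each w, and the element d can be combined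
    freely.\<close>
  have coset: "(restrict c \<Omega>, d) \<in> (a, b) <#\<^bsub>cgroup W\<^esub> csub W x" if m: "(x, (a, b)) \<in> T" for x a b
    unfolding mem_wreath_lcoset[OF inT[OF m]]
  proof (intro conjI ballI)
    show "restrict c \<Omega> \<in> \<Omega> \<rightarrow>\<^sub>E carrier (cgroup \<alpha>)" using c(1) by auto
    show "d \<in> b <#\<^bsub>cgroup \<beta>\<^esub> top_part x"
    proof (cases x)
      case (Inl L)
      then show ?thesis using d(1) inT(3)[OF m] B.mem_lcoset[OF B.G.subgroup_self] by simp
    next
      case (Inr i)
      then show ?thesis using d(2) m by simp
    qed
    fix e assume e: "e \<in> fixed_types x"
    obtain j l where jl: "e = (j, l)" by fastforce
    have "\<phi> b l \<in> \<Omega>" using e jl fixed_types_subset[OF inT(1)[OF m]] inT(3)[OF m] by auto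
    then show "case e of (j, l) \<Rightarrow> restrict c \<Omega> (\<phi> b l) \<in> a (\<phi> b l) <#\<^bsub>cgroup \<alpha>\<^esub> csub \<alpha> j"
      using c(2)[OF m] e jl by simp
  qed
  have "(restrict c \<Omega>, d) \<in> carrier (cgroup W)" using c(1) d(1) by auto
  then show "\<exists>z\<in>carrier (cgroup W). \<forall>(x, g)\<in>T. z \<in> g <#\<^bsub>cgroup W\<^esub> csub W x"
  proof (rule rev_bexI, intro ballI)
    fix p assume p: "p \<in> T"
    obtain x a b where "p = (x, (a, b))" using prod_cases3 .
    then show "case p of (x, g) \<Rightarrow> (restrict c \<Omega>, d) \<in> g <#\<^bsub>cgroup W\<^esub> csub W x"
      using coset p by simp
  qed
qed

section \<open>Parabolic subgroups of the wreath product\<close>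

lemma rep_orbit_Inter:
  assumes L: "L \<in> K" and "finite J" "J \<subseteq> ctypes \<beta>" "e \<in> L"
    and "\<And>i. i \<in> J \<Longrightarrow> e \<in> rep_orbit (csub \<beta> i) L"
  shows "e \<in> rep_orbit (parabolic \<beta> J) L"
  using assms(2-)
proof (induction J)
  case empty
  then show ?case using rep_orbit_carrier[OF L] by (simp add: parabolic_def)
next
  case (insert i J)
  have ipo: "IPO_point \<beta> tact (rep L)"
    using representatives L by (simp add: admissible_representatives_def)
  \<comment> \<open>The intersection property is stated with complements, so it is applied to the
    complements of J and {i}; the intersection of these is the complement of
    \<open>insert i J\<close>.\<close>
  have "rep_orbit (parabolic \<beta> (ctypes \<beta> - (ctypes \<beta> - J))) L
      \<inter> rep_orbit (parabolic \<beta> (ctypes \<beta> - (ctypes \<beta> - {i}))) L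
      = rep_orbit (parabolic \<beta> (ctypes \<beta> - (ctypes \<beta> - J) \<inter> (ctypes \<beta> - {i}))) L"
    by (rule ipo[unfolded IPO_point_def, rule_format]) blast
  moreover have "ctypes \<beta> - (ctypes \<beta> - J) = J" "ctypes \<beta> - (ctypes \<beta> - {i}) = {i}"
    "ctypes \<beta> - (ctypes \<beta> - J) \<inter> (ctypes \<beta> - {i}) = insert i J"
    using insert.prems(1) by auto
  moreover have "parabolic \<beta> {i} = csub \<beta> i"
    using subgroup.subset[OF B.csub_subgroup, of i] insert.prems(1) by (auto simp: parabolic_def)
  ultimately have "rep_orbit (parabolic \<beta> J) L \<inter> rep_orbit (csub \<beta> i) L = rep_orbit (parabolic \<beta> (insert i J)) L"
    by simp
  then show ?case using insert.IH insert.prems by blast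
qed

text \<open>The types at which G_J imposes no condition on the base group. An orbit in J is fixed
  entirely. In any other orbit L, the types left free by every i in J form the intersection of the
  B_i-orbits of \<open>rep L\<close>, which is its B_J-orbit.\<close>

definition free_types :: "(('i \<times> 'w) set + 'j) set \<Rightarrow> ('i \<times> 'w) set" where
  "free_types J = (\<Union>L\<in>{L \<in> K. Inl L \<notin> J}. rep_orbit (parabolic \<beta> (Inr -` J)) L)"

lemma free_typesI:
  assumes "L \<in> K" "Inl L \<notin> J" "h \<in> parabolic \<beta> (Inr -` J)" "e = tact h (rep L)"
  shows "e \<in> free_types J"
  using assms by (auto simp: free_types_def mem_rep_orbit)

text \<open>The union of the \<open>fixed_types x\<close> for x in J is the complement of
  \<open>free_types J\<close>. That every type outside \<open>free_types J\<close> is fixed by some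
  x rests on \<open>rep_orbit_Inter\<close>; the reverse inclusion follows from monotonicity of
  orbits and disjointness of the orbits L.\<close>

lemma parabolic_wreath:
  assumes J: "J \<subseteq> ctypes W"
  shows "(n, h) \<in> parabolic W J \<longleftrightarrow> n \<in> \<Omega> \<rightarrow>\<^sub>E carrier (cgroup \<alpha>) \<and>
    h \<in> parabolic \<beta> (Inr -` J) \<and> (\<forall>(j, l)\<in>ctypes \<alpha> \<times> \<Omega> - free_types J. n l \<in> csub \<alpha> j)" (is "?L \<longleftrightarrow> ?R")
proof
  assume ?L
  then have carr: "n \<in> \<Omega> \<rightarrow>\<^sub>E carrier (cgroup \<alpha>)" "h \<in> carrier (cgroup \<beta>)"
    and mem: "\<And>x. x \<in> J \<Longrightarrow> h \<in> top_part x \<and> (\<forall>(j, l)\<in>fixed_types x. n l \<in> csub \<alpha> j)"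
    by (auto simp: parabolic_def csub_wreath)
  have "h \<in> parabolic \<beta> (Inr -` J)" using carr(2) mem[of "Inr _"] by (auto simp: parabolic_def)
  moreover have "n l \<in> csub \<alpha> j" if jl: "(j, l) \<in> ctypes \<alpha> \<times> \<Omega>" "(j, l) \<notin> free_types J" for j l
  proof -
    obtain L where L: "L \<in> K" "(j, l) \<in> L" using orbit_cover[OF jl(1)] by blast
    show ?thesis
    proof (cases "Inl L \<in> J")
      case True
      then show ?thesis using mem[OF True] L(2) by auto
    next
      case False
      then have "(j, l) \<notin> rep_orbit (parabolic \<beta> (Inr -` J)) L"
        using jl(2) L(1) by (auto simp: free_types_def)
      moreover have "Inr -` J \<subseteq> ctypes \<beta>" using J by auto
      ultimately obtain i where i: "Inr i \<in> J" "(j, l) \<notin> rep_orbit (csub \<beta> i) L"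
        using rep_orbit_Inter[OF L(1) finite_subset[OF _ B.finite_types] _ L(2)] by blast
      then have "(j, l) \<in> fixed_types (Inr i)" using L by auto
      then show ?thesis using mem[OF i(1)] by blast
    qed
  qed
  ultimately show ?R using carr(1) by auto
next
  assume R: ?R
  have "(n, h) \<in> csub W x" if x: "x \<in> J" for x
    unfolding csub_wreath
  proof (intro conjI ballI)
    show "n \<in> \<Omega> \<rightarrow>\<^sub>E carrier (cgroup \<alpha>)" using R by blast
    show "h \<in> top_part x" using R x by (cases x) (auto simp: parabolic_def)
    fix e assume e: "e \<in> fixed_types x"
    have "e \<notin> free_types J"
    proof
      assume "e \<in> free_types J"
      then obtain L where L: "L \<in> K" "Inl L \<notin> J" "e \<in> rep_orbit (parabolic \<beta> (Inr -` J)) L"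
        unfolding free_types_def by blast
      have "e \<in> L"
        using L(3) rep_orbit_mono[of "parabolic \<beta> (Inr -` J)" "carrier (cgroup \<beta>)" L] rep_orbit_carrier[OF L(1)]
        by (auto simp: parabolic_def)
      show False
      proof (cases x)
        case (Inl M)
        then show False using orbit_unique[of M L e] e x L J \<open>e \<in> L\<close> by auto
      next
        case (Inr i)
        then obtain M where M: "M \<in> K" "e \<in> M" "e \<notin> rep_orbit (csub \<beta> i) M"
          using e unfolding Inr fixed_types_simps by blast
        have "M = L" using orbit_unique M L \<open>e \<in> L\<close> by blast
        moreover have "parabolic \<beta> (Inr -` J) \<subseteq> csub \<beta> i" using x Inr by (auto simp: parabolic_def)
        ultimately show False using M(3) L(3) rep_orbit_mono by blast
      qed
    qed
    moreover have "e \<in> ctypes \<alpha> \<times> \<Omega>" using e fixed_types_subset x J by blast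
    ultimately show "case e of (j, l) \<Rightarrow> n l \<in> csub \<alpha> j" using R by auto
  qed
  then show ?L using R by (auto simp: parabolic_def)
qed

section \<open>Elements supported at one point, and elements of B\<close>

definition single :: "'w \<Rightarrow> 'a \<Rightarrow> 'w \<Rightarrow> 'a" where
  "single l x = (\<lambda>w\<in>\<Omega>. if w = l then x else \<one>\<^bsub>cgroup \<alpha>\<^esub>)"

text \<open>As homomorphisms, this map and the embedding of B carry generation of parabolic
  subgroups of \<alpha> and \<beta> over to the wreath product.\<close>

lemma single_hom: "group_hom (cgroup \<alpha>) (cgroup W) (\<lambda>x. (single l x, \<one>\<^bsub>cgroup \<beta>\<^esub>))"
  by (intro group_hom.intro group_hom_axioms.intro homI A.G.is_group W.G.is_group)
    (auto simp: single_def fun_eq_iff)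

lemma top_hom: "group_hom (cgroup \<beta>) (cgroup W) (\<lambda>h. (\<lambda>w\<in>\<Omega>. \<one>\<^bsub>cgroup \<alpha>\<^esub>, h))"
  by (intro group_hom.intro group_hom_axioms.intro homI B.G.is_group W.G.is_group)
    (auto simp: fun_eq_iff)

text \<open>At coordinates other than l the entry is 1, which lies in every subgroup; only the types
  at l restrict x.\<close>

lemma single_parabolic:
  assumes J: "J \<subseteq> ctypes W" and l: "l \<in> \<Omega>" and x: "x \<in> parabolic \<alpha> {j \<in> ctypes \<alpha>. (j, l) \<notin> free_types J}"
  shows "(single l x, \<one>\<^bsub>cgroup \<beta>\<^esub>) \<in> parabolic W J"
proof -
  have "Inr -` J \<subseteq> ctypes \<beta>" using J by auto
  then show ?thesis
    using l x subgroup.one_closed[OF B.parabolic_subgroup] subgroup.one_closed[OF A.csub_subgroup]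
    unfolding parabolic_wreath[OF J] by (auto simp: single_def parabolic_def)
qed

lemma top_parabolic:
  assumes J: "J \<subseteq> ctypes W" and h: "h \<in> parabolic \<beta> (Inr -` J)"
  shows "(\<lambda>w\<in>\<Omega>. \<one>\<^bsub>cgroup \<alpha>\<^esub>, h) \<in> parabolic W J"
  using h subgroup.one_closed[OF A.csub_subgroup]
  unfolding parabolic_wreath[OF J] by auto

end

section \<open>Residual connectedness of the wreath product\<close>

locale flag_transitive_wreath_system = wreath_coset_system +
  assumes flag_transitive_bottom: "flag_transitive \<alpha>" and flag_transitive_top: "flag_transitive \<beta>"
begin

sublocale A: flag_transitive_system \<alpha>
  by standard (rule flag_transitive_bottom)

sublocale B: flag_transitive_system \<beta>
  by standard (rule flag_transitive_top)

sublocale W: flag_transitive_system W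
  by standard (rule wreath_flag_transitive[OF flag_transitive_bottom flag_transitive_top])

text \<open>An element (n, h) of G_J is the product of the one-point elements with entries n l and
  of h. Each of these factors again lies in G_J by \<open>parabolic_wreath\<close>, and each is
  shown separately to lie in the generated subgroup H.\<close>

lemma generated_by_larger_wreath:
  assumes rcA: "residually_connected (coset_incidence \<alpha>)" and rcB: "residually_connected (coset_incidence \<beta>)"
    and J: "J \<subseteq> ctypes W" and card: "2 \<le> card (ctypes W - J)"
  shows "W.generated_by_larger J"
proof
  define U where "U = (\<Union>t\<in>ctypes W - J. parabolic W (insert t J))"
  define H where "H = generate (cgroup W) U"
  have U: "U \<subseteq> carrier (cgroup W)" by (auto simp: U_def parabolic_def)
  have H: "subgroup H (cgroup W)" unfolding H_def by (rule W.G.generate_is_subgroup[OF U])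
  have inclU: "g \<in> U" if "t \<in> ctypes W - J" "g \<in> parabolic W (insert t J)" for t g
    using that unfolding U_def by blast
  then have incl: "g \<in> H" if "t \<in> ctypes W - J" "g \<in> parabolic W (insert t J)" for t g
    unfolding H_def using that generate.incl by metis
  have hom: "f x \<in> H" if "group_hom G (cgroup W) f" "X \<subseteq> carrier G" "f ` X \<subseteq> U" "x \<in> generate G X"
    for f G X and x :: 'z
    using group_hom.generate_img[OF that(1,2)] W.G.mono_generate[OF that(3)] that(4) unfolding H_def by blast
  have vJ: "Inr -` J \<subseteq> ctypes \<beta>" and vInl: "\<And>L. Inr -` insert (Inl L) J = Inr -` J"
    and vInr: "\<And>i. Inr -` insert (Inr i) J = insert i (Inr -` J)" using J by auto
  \<comment> \<open>Adding a missing orbit L to J leaves the condition on h unchanged. If no orbit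
    is missing, at least two types of \<beta> are, and residual connectedness of \<beta>
    applies.\<close>
  have top: "(\<lambda>w\<in>\<Omega>. \<one>\<^bsub>cgroup \<alpha>\<^esub>, h) \<in> H" if h: "h \<in> parabolic \<beta> (Inr -` J)" for h
  proof (cases "\<exists>L\<in>K. Inl L \<notin> J")
    case True
    then obtain L where L: "L \<in> K" "Inl L \<notin> J" by blast
    then have "insert (Inl L) J \<subseteq> ctypes W" "Inl L \<in> ctypes W - J" using J by auto
    then show ?thesis using incl top_parabolic h vInl by metis
  next
    case False
    then have "ctypes W - J = Inr ` (ctypes \<beta> - Inr -` J)" by auto
    then have "2 \<le> card (ctypes \<beta> - Inr -` J)" using card by (simp add: card_image)
    then have gen: "h \<in> generate (cgroup \<beta>) (\<Union>i\<in>ctypes \<beta> - Inr -` J. parabolic \<beta> (insert i (Inr -` J)))"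
      using rcB vJ h unfolding B.residually_connected_iff by blast
    show ?thesis
    proof (rule hom[OF top_hom _ _ gen])
      show "(\<lambda>h. (\<lambda>w\<in>\<Omega>. \<one>\<^bsub>cgroup \<alpha>\<^esub>, h)) ` (\<Union>i\<in>ctypes \<beta> - Inr -` J. parabolic \<beta> (insert i (Inr -` J))) \<subseteq> U"
      proof (rule image_subsetI)
        fix k assume "k \<in> (\<Union>i\<in>ctypes \<beta> - Inr -` J. parabolic \<beta> (insert i (Inr -` J)))"
        then obtain i where i: "i \<in> ctypes \<beta>" "Inr i \<notin> J" "k \<in> parabolic \<beta> (insert i (Inr -` J))" by blast
        then have "insert (Inr i) J \<subseteq> ctypes W" "Inr i \<in> ctypes W - J" using J by auto
        then show "(\<lambda>w\<in>\<Omega>. \<one>\<^bsub>cgroup \<alpha>\<^esub>, k) \<in> U" using inclU top_parabolic i(3) vInr by metis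
      qed
    qed (auto simp: parabolic_def)
  qed
  have single: "(single l x, \<one>\<^bsub>cgroup \<beta>\<^esub>) \<in> H"
    if l: "l \<in> \<Omega>" and x: "x \<in> parabolic \<alpha> {j \<in> ctypes \<alpha>. (j, l) \<notin> free_types J}" for l x
  proof -
    \<comment> \<open>The types of \<alpha> that are free at l, so x lies in the parabolic subgroup
      of the complement of \<open>D\<close>. Residual connectedness of \<alpha> covers the case of
      at least two such types; the other two cases need only a suitable t.\<close>
    define D where "D = {j \<in> ctypes \<alpha>. (j, l) \<in> free_types J}"
    have ID: "ctypes \<alpha> - (ctypes \<alpha> - D) = D" "{j \<in> ctypes \<alpha>. (j, l) \<notin> free_types J} = ctypes \<alpha> - D"
      by (auto simp: D_def)
    have finD: "finite D" using A.finite_types by (simp add: D_def)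
    have xD: "x \<in> parabolic \<alpha> (ctypes \<alpha> - D)" using x ID(2) by simp
    have orbit_of: "\<exists>L h. L \<in> K \<and> Inl L \<notin> J \<and> h \<in> parabolic \<beta> (Inr -` J) \<and> (j, l) = tact h (rep L)" if "j \<in> D" for j
      using that unfolding D_def free_types_def UN_iff mem_rep_orbit by blast
    have single_incl: "(single l y, \<one>\<^bsub>cgroup \<beta>\<^esub>) \<in> U"
      if "t \<in> ctypes W - J" "y \<in> parabolic \<alpha> {j \<in> ctypes \<alpha>. (j, l) \<notin> free_types (insert t J)}" for t y
      by (rule inclU[OF that(1)], rule single_parabolic[OF _ l that(2)]) (use J that(1) in blast)
    consider "2 \<le> card D" | "D = {}" | j where "D = {j}"
    proof -
      have "card D = 0 \<or> card D = 1 \<or> 2 \<le> card D" by linarith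
      then show thesis using that finD by (auto simp: card_1_singleton_iff)
    qed
    then show ?thesis
    proof cases
      case 1
      then have "A.generated_by_larger (ctypes \<alpha> - D)"
        using rcA unfolding A.residually_connected_iff
        by (elim allE[of _ "ctypes \<alpha> - D"]) (simp add: ID(1))
      then have gen: "x \<in> generate (cgroup \<alpha>) (\<Union>j\<in>D. parabolic \<alpha> (insert j (ctypes \<alpha> - D)))"
        using xD unfolding ID(1) by blast
      show ?thesis
      proof (rule hom[OF single_hom _ _ gen])
        show "(\<lambda>x. (single l x, \<one>\<^bsub>cgroup \<beta>\<^esub>)) ` (\<Union>j\<in>D. parabolic \<alpha> (insert j (ctypes \<alpha> - D))) \<subseteq> U"
        proof (rule image_subsetI)
          fix y assume "y \<in> (\<Union>j\<in>D. parabolic \<alpha> (insert j (ctypes \<alpha> - D)))"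
          then obtain j where j: "j \<in> D" "y \<in> parabolic \<alpha> (insert j (ctypes \<alpha> - D))" by blast
          obtain L h where L: "L \<in> K" "Inl L \<notin> J" "h \<in> parabolic \<beta> (Inr -` J)" "(j, l) = tact h (rep L)"
            using orbit_of[OF j(1)] by blast
          \<comment> \<open>B preserves first components, so (k, l) and (j, l) lie in different
            orbits, and adding L to J leaves (k, l) free.\<close>
          have "(k, l) \<in> free_types (insert (Inl L) J)" if k: "k \<in> D" "k \<noteq> j" for k
          proof -
            obtain M g where M: "M \<in> K" "Inl M \<notin> J" "g \<in> parabolic \<beta> (Inr -` J)" "(k, l) = tact g (rep M)"
              using orbit_of[OF k(1)] by blast
            have "fst (rep M) = k" "fst (rep L) = j"
              using M(4) L(4) rep_in_types[OF M(1)] rep_in_types[OF L(1)] by (auto split: prod.splits simp: type_action_def)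
            then have "M \<noteq> L" using k(2) by blast
            then show ?thesis using M by (intro free_typesI) (auto simp: vInl)
          qed
          then have "{k \<in> ctypes \<alpha>. (k, l) \<notin> free_types (insert (Inl L) J)} \<subseteq> insert j (ctypes \<alpha> - D)" by blast
          then have "y \<in> parabolic \<alpha> {k \<in> ctypes \<alpha>. (k, l) \<notin> free_types (insert (Inl L) J)}"
            using j(2) by (auto simp: parabolic_def)
          then show "(single l y, \<one>\<^bsub>cgroup \<beta>\<^esub>) \<in> U" using L by (intro single_incl) auto
        qed
      qed (auto simp: parabolic_def)
    next
      case 2
      \<comment> \<open>Here x lies in the Borel subgroup of \<alpha>, hence satisfies every
        condition, whichever type t is added.\<close>
      then have x': "x \<in> parabolic \<alpha> (ctypes \<alpha>)" using xD by simp
      obtain t where t: "t \<in> ctypes W - J" using card by (metis card.empty ex_in_conv not_numeral_le_zero)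
      have "x \<in> parabolic \<alpha> {j \<in> ctypes \<alpha>. (j, l) \<notin> free_types (insert t J)}"
        using x' by (auto simp: parabolic_def)
      from single_incl[OF t this] show ?thesis unfolding H_def by (rule generate.incl)
    next
      case (3 j)
      then obtain L b where L: "L \<in> K" "Inl L \<notin> J" "b \<in> parabolic \<beta> (Inr -` J)" "(j, l) = tact b (rep L)"
        using orbit_of by blast
      \<comment> \<open>Since at least two types are missing from J, some t other than L can be
        added. If t is another orbit M, then (j, l) stays free.\<close>
      have "\<not> ctypes W - J \<subseteq> {Inl L}"
        using card card_mono[of "{Inl L}" "ctypes W - J"] by fastforce
      then obtain t where t: "t \<in> ctypes W - J" "t \<noteq> Inl L" by blast
      show ?thesis
      proof (cases t)
        case (Inl M)
        then have "(j, l) \<in> free_types (insert t J)"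
          using L t by (intro free_typesI[OF L(1)]) (auto simp: vInl)
        then have "{k \<in> ctypes \<alpha>. (k, l) \<notin> free_types (insert t J)} \<subseteq> ctypes \<alpha> - D" using 3 by blast
        then have "x \<in> parabolic \<alpha> {k \<in> ctypes \<alpha>. (k, l) \<notin> free_types (insert t J)}"
          using xD by (auto simp: parabolic_def)
        from single_incl[OF t(1) this] show ?thesis unfolding H_def by (rule generate.incl)
      next
        case (Inr i)
        \<comment> \<open>Adding \<open>i\<close> to \<open>J\<close> may remove \<open>(j, l)\<close> from the orbit of \<open>rep L\<close>, but not \<open>rep L\<close>
          itself, so conjugate \<open>l\<close> to the coordinate of \<open>rep L\<close>.\<close>
        obtain l' where r: "rep L = (j, l')" "l' \<in> \<Omega>" "\<phi> b l' = l"
          using L(4) rep_in_types[OF L(1)] by (cases "rep L") (auto simp: type_action_def)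
        have b: "b \<in> carrier (cgroup \<beta>)" using L(3) by (simp add: parabolic_def)
        have "\<one>\<^bsub>cgroup \<beta>\<^esub> \<in> parabolic \<beta> (Inr -` insert t J)"
          using J t(1) by (intro subgroup.one_closed[OF B.parabolic_subgroup]) auto
        moreover have "j \<in> ctypes \<alpha>" using rep_in_types[OF L(1)] r by simp
        ultimately have "(j, l') \<in> free_types (insert t J)"
          using L(1,2) t(2) r by (intro free_typesI[of L]) auto
        then have "{k \<in> ctypes \<alpha>. (k, l') \<notin> free_types (insert t J)} \<subseteq> ctypes \<alpha> - D" using 3 by blast
        then have "x \<in> parabolic \<alpha> {k \<in> ctypes \<alpha>. (k, l') \<notin> free_types (insert t J)}"
          using xD by (auto simp: parabolic_def)
        then have s': "(single l' x, \<one>\<^bsub>cgroup \<beta>\<^esub>) \<in> H"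
          using J t(1) by (intro incl[OF t(1)] single_parabolic r(2)) blast
        let ?b = "(\<lambda>w\<in>\<Omega>. \<one>\<^bsub>cgroup \<alpha>\<^esub>, b)"
        have xc: "x \<in> carrier (cgroup \<alpha>)" using xD by (simp add: parabolic_def)
        have "\<phi> (inv\<^bsub>cgroup \<beta>\<^esub> b) w = l' \<longleftrightarrow> w = l" if "w \<in> \<Omega>" for w
          using act_inv[OF b] r that by metis
        \<comment> \<open>Conjugation by b moves the support from l' to \<phi> b l' = l.\<close>
        then have "?b \<otimes>\<^bsub>cgroup W\<^esub> (single l' x, \<one>\<^bsub>cgroup \<beta>\<^esub>) = (single l x, \<one>\<^bsub>cgroup \<beta>\<^esub>) \<otimes>\<^bsub>cgroup W\<^esub> ?b"
          using b xc by (auto simp: single_def fun_eq_iff)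
        moreover have "?b \<in> carrier (cgroup W)" "(single l x, \<one>\<^bsub>cgroup \<beta>\<^esub>) \<in> carrier (cgroup W)"
          using b xc by (auto simp: single_def)
        ultimately have "(single l x, \<one>\<^bsub>cgroup \<beta>\<^esub>) =
            (?b \<otimes>\<^bsub>cgroup W\<^esub> (single l' x, \<one>\<^bsub>cgroup \<beta>\<^esub>)) \<otimes>\<^bsub>cgroup W\<^esub> inv\<^bsub>cgroup W\<^esub> ?b"
          using W.G.inv_solve_right' by (metis W.G.inv_solve_right W.G.m_closed)
        then show ?thesis
          using top[OF L(3)] s' subgroup.m_closed[OF H] subgroup.m_inv_closed[OF H] by metis
      qed
    qed
  qed
  fix g assume g: "g \<in> parabolic W J"
  obtain n h where nh: "g = (n, h)" by fastforce
  have n: "n \<in> \<Omega> \<rightarrow>\<^sub>E carrier (cgroup \<alpha>)" "h \<in> parabolic \<beta> (Inr -` J)"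
    "\<And>j l. j \<in> ctypes \<alpha> \<Longrightarrow> l \<in> \<Omega> \<Longrightarrow> (j, l) \<notin> free_types J \<Longrightarrow> n l \<in> csub \<alpha> j"
    using g unfolding nh parabolic_wreath[OF J] by auto
  \<comment> \<open>The base component n is assembled one coordinate at a time, which uses that
    \<Omega> is finite.\<close>
  have "(\<lambda>w\<in>\<Omega>. if w \<in> M then n w else \<one>\<^bsub>cgroup \<alpha>\<^esub>, \<one>\<^bsub>cgroup \<beta>\<^esub>) \<in> H" if "finite M" "M \<subseteq> \<Omega>" for M
    using that
  proof (induction M)
    case empty
    show ?case using subgroup.one_closed[OF H] by (simp add: restrict_def)
  next
    case (insert l M)
    have "(single l (n l), \<one>\<^bsub>cgroup \<beta>\<^esub>) \<in> H"
      using insert.prems n by (intro single) (auto simp: parabolic_def)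
    then have "(\<lambda>w\<in>\<Omega>. if w \<in> M then n w else \<one>\<^bsub>cgroup \<alpha>\<^esub>, \<one>\<^bsub>cgroup \<beta>\<^esub>) \<otimes>\<^bsub>cgroup W\<^esub> (single l (n l), \<one>\<^bsub>cgroup \<beta>\<^esub>) \<in> H"
      using insert subgroup.m_closed[OF H] by blast
    moreover have "(\<lambda>w\<in>\<Omega>. if w \<in> M then n w else \<one>\<^bsub>cgroup \<alpha>\<^esub>, \<one>\<^bsub>cgroup \<beta>\<^esub>) \<otimes>\<^bsub>cgroup W\<^esub> (single l (n l), \<one>\<^bsub>cgroup \<beta>\<^esub>)
        = (\<lambda>w\<in>\<Omega>. if w \<in> insert l M then n w else \<one>\<^bsub>cgroup \<alpha>\<^esub>, \<one>\<^bsub>cgroup \<beta>\<^esub>)"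
      using insert.hyps insert.prems n(1) by (auto simp: single_def fun_eq_iff PiE_iff)
    ultimately have "(\<lambda>w\<in>\<Omega>. if w \<in> insert l M then n w else \<one>\<^bsub>cgroup \<alpha>\<^esub>, \<one>\<^bsub>cgroup \<beta>\<^esub>) \<in> H"
      by metis
    then show ?case by (simp add: restrict_def)
  qed
  from this[OF finite_points subset_refl] top[OF n(2)]
  have "(\<lambda>w\<in>\<Omega>. if w \<in> \<Omega> then n w else \<one>\<^bsub>cgroup \<alpha>\<^esub>, \<one>\<^bsub>cgroup \<beta>\<^esub>) \<otimes>\<^bsub>cgroup W\<^esub> (\<lambda>w\<in>\<Omega>. \<one>\<^bsub>cgroup \<alpha>\<^esub>, h) \<in> H"
    by (rule subgroup.m_closed[OF H])
  moreover have "h \<in> carrier (cgroup \<beta>)" using n(2) by (simp add: parabolic_def)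
  then have "(\<lambda>w\<in>\<Omega>. if w \<in> \<Omega> then n w else \<one>\<^bsub>cgroup \<alpha>\<^esub>, \<one>\<^bsub>cgroup \<beta>\<^esub>) \<otimes>\<^bsub>cgroup W\<^esub> (\<lambda>w\<in>\<Omega>. \<one>\<^bsub>cgroup \<alpha>\<^esub>, h) = g"
    using n(1) by (auto simp: nh fun_eq_iff PiE_iff extensional_def)
  ultimately show "g \<in> generate (cgroup W) (\<Union>t\<in>ctypes W - J. parabolic W (insert t J))"
    unfolding H_def U_def by simp
qed

theorem wreath_residually_connected:
  assumes "residually_connected (coset_incidence \<alpha>)" "residually_connected (coset_incidence \<beta>)"
  shows "residually_connected (coset_incidence W)"
  unfolding W.residually_connected_iff using generated_by_larger_wreath[OF assms] by blast

section \<open>Firmness and thinness of the wreath product\<close>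

lemma tact_one_rep:
  assumes "L \<in> K"
  shows "tact \<one>\<^bsub>cgroup \<beta>\<^esub> (rep L) = rep L"
  using rep_in_types[OF assms] by (cases "rep L") simp

lemma vimage_Inr_types:
  "Inr -` ctypes W = ctypes \<beta>" "Inr -` (ctypes W - {Inl L}) = ctypes \<beta>"
  "Inr -` (ctypes W - {Inr i}) = ctypes \<beta> - {i}"
  by auto

text \<open>For an orbit L with \<open>rep L\<close> = (j, l), a witness for \<alpha> at j is placed
  at coordinate l: the type (j, l) is free when only L is missing, whereas the subgroup of type L
  does restrict it. For a type of \<beta>, a witness in B is embedded.\<close>

theorem wreath_firm:
  assumes "firm (coset_incidence \<alpha>)" "firm (coset_incidence \<beta>)"
  shows "firm (coset_incidence W)"
  unfolding W.firm_iff
proof (intro ballI notI)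
  fix t assume t: "t \<in> ctypes W" and sub: "parabolic W (ctypes W - {t}) \<subseteq> csub W t"
  show False
  proof (cases t)
    case (Inl L)
    then have L: "L \<in> K" using t by auto
    obtain j l where jl: "rep L = (j, l)" "j \<in> ctypes \<alpha>" "l \<in> \<Omega>" using rep_in_types[OF L] by blast
    obtain y where y: "y \<in> parabolic \<alpha> (ctypes \<alpha> - {j})" "y \<notin> csub \<alpha> j"
      using assms(1) jl(2) unfolding A.firm_iff by blast
    have "\<one>\<^bsub>cgroup \<beta>\<^esub> \<in> parabolic \<beta> (Inr -` (ctypes W - {t}))"
      by (intro subgroup.one_closed[OF B.parabolic_subgroup]) auto
    then have "rep L \<in> free_types (ctypes W - {t})"
      using tact_one_rep[OF L] L Inl by (intro free_typesI[of L]) auto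
    then have "{k \<in> ctypes \<alpha>. (k, l) \<notin> free_types (ctypes W - {t})} \<subseteq> ctypes \<alpha> - {j}"
      unfolding jl(1) by blast
    then have "y \<in> parabolic \<alpha> {k \<in> ctypes \<alpha>. (k, l) \<notin> free_types (ctypes W - {t})}"
      using y(1) unfolding parabolic_def by blast
    from single_parabolic[OF Diff_subset jl(3) this]
    have "(single l y, \<one>\<^bsub>cgroup \<beta>\<^esub>) \<in> csub W t" using sub by blast
    then have "single l y l \<in> csub \<alpha> j"
      using rep_in_orbit[OF L] unfolding csub_wreath Inl jl(1) by auto
    then show False using y(2) jl(3) by (simp add: single_def)
  next
    case (Inr i)
    then have "i \<in> ctypes \<beta>" using t by auto
    then obtain y where y: "y \<in> parabolic \<beta> (ctypes \<beta> - {i})" "y \<notin> csub \<beta> i"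
      using assms(2) unfolding B.firm_iff by blast
    then have "(\<lambda>w\<in>\<Omega>. \<one>\<^bsub>cgroup \<alpha>\<^esub>, y) \<in> csub W t"
      using top_parabolic[of "ctypes W - {t}" y] sub unfolding Inr vimage_Inr_types by blast
    then show False using y(2) by (simp add: csub_wreath Inr)
  qed
qed

text \<open>With trivial Borel subgroups, the parabolic subgroup missing only L is a copy of the one
  of \<alpha> missing j, placed at coordinate l, where \<open>rep L\<close> = (j, l). The one
  missing only i is a copy of that of \<beta> missing i.\<close>

theorem wreath_thin:
  assumes "thin_coset_geometry \<alpha>" "thin_coset_geometry \<beta>"
  shows "thin_coset_geometry W"
proof -
  have borelA: "borel \<alpha> = {\<one>\<^bsub>cgroup \<alpha>\<^esub>}" and borelB: "borel \<beta> = {\<one>\<^bsub>cgroup \<beta>\<^esub>}"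
    using assms by (simp_all add: thin_coset_geometry_def)
  have cardA: "card (parabolic \<alpha> (ctypes \<alpha> - {j})) = 2" if "j \<in> ctypes \<alpha>" for j
    using assms(1) that A.thin_iff[OF borelA] by (simp add: thin_coset_geometry_def)
  have cardB: "card (parabolic \<beta> (ctypes \<beta> - {i})) = 2" if "i \<in> ctypes \<beta>" for i
    using assms(2) that B.thin_iff[OF borelB] by (simp add: thin_coset_geometry_def)
  \<comment> \<open>An entry restricted by all types of \<alpha> lies in the Borel subgroup.\<close>
  have trivial: "n w = \<one>\<^bsub>cgroup \<alpha>\<^esub>"
    if "n \<in> \<Omega> \<rightarrow>\<^sub>E carrier (cgroup \<alpha>)" "w \<in> \<Omega>" "\<And>j. j \<in> ctypes \<alpha> \<Longrightarrow> n w \<in> csub \<alpha> j" for n w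
  proof -
    have "n w \<in> borel \<alpha>" using that unfolding borel_def parabolic_def by blast
    then show ?thesis using borelA by simp
  qed
  have ext: "n = (\<lambda>w\<in>\<Omega>. \<one>\<^bsub>cgroup \<alpha>\<^esub>)"
    if "n \<in> \<Omega> \<rightarrow>\<^sub>E carrier (cgroup \<alpha>)" "\<And>j w. j \<in> ctypes \<alpha> \<Longrightarrow> w \<in> \<Omega> \<Longrightarrow> n w \<in> csub \<alpha> j" for n
    by (rule extensionalityI[of _ \<Omega>]) (use that trivial[of n] in \<open>auto simp: PiE_iff\<close>)
  \<comment> \<open>This is part of the conclusion and also the hypothesis of
    \<open>W.thin_iff\<close>.\<close>
  have borelW: "borel W = {\<one>\<^bsub>cgroup W\<^esub>}"
  proof (intro subset_antisym subsetI)
    fix g assume g: "g \<in> borel W"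
    obtain n h where nh: "g = (n, h)" by fastforce
    have "free_types (ctypes W) = {}" by (auto simp: free_types_def)
    then have "n \<in> \<Omega> \<rightarrow>\<^sub>E carrier (cgroup \<alpha>)" "h \<in> borel \<beta>"
      "\<And>j w. j \<in> ctypes \<alpha> \<Longrightarrow> w \<in> \<Omega> \<Longrightarrow> n w \<in> csub \<alpha> j"
      using g unfolding nh borel_def parabolic_wreath[OF subset_refl] vimage_Inr_types by auto
    then show "g \<in> {\<one>\<^bsub>cgroup W\<^esub>}" using ext borelB nh by simp
  next
    fix g assume "g \<in> {\<one>\<^bsub>cgroup W\<^esub>}"
    then show "g \<in> borel W"
      unfolding borel_def using subgroup.one_closed[OF W.parabolic_subgroup[OF subset_refl]] by simp
  qed
  have "card (parabolic W (ctypes W - {t})) = 2" if t: "t \<in> ctypes W" for t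
  proof (cases t)
    case (Inl L)
    then have L: "L \<in> K" using t by auto
    obtain j l where jl: "rep L = (j, l)" "j \<in> ctypes \<alpha>" "l \<in> \<Omega>" using rep_in_types[OF L] by blast
    have "{M \<in> K. Inl M \<notin> ctypes W - {t}} = {L}" using L Inl by auto
    \<comment> \<open>All types of \<beta> are present, so only the trivial group acts on
      \<open>rep L\<close>, which leaves a single free type.\<close>
    moreover have "rep_orbit (borel \<beta>) L = {rep L}"
      unfolding set_eq_iff mem_rep_orbit borelB using tact_one_rep[OF L] by simp
    ultimately have free: "free_types (ctypes W - {t}) = {(j, l)}"
      by (simp add: free_types_def Inl vimage_Inr_types borel_def jl(1) del: ctypes_wreath)
    have "parabolic W (ctypes W - {t}) = (\<lambda>x. (single l x, \<one>\<^bsub>cgroup \<beta>\<^esub>)) ` parabolic \<alpha> (ctypes \<alpha> - {j})"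
    proof (intro subset_antisym subsetI)
      fix g assume g: "g \<in> parabolic W (ctypes W - {t})"
      obtain n h where nh: "g = (n, h)" by fastforce
      have n: "n \<in> \<Omega> \<rightarrow>\<^sub>E carrier (cgroup \<alpha>)" "h \<in> parabolic \<beta> (Inr -` (ctypes W - {t}))"
        "\<And>k w. k \<in> ctypes \<alpha> \<Longrightarrow> w \<in> \<Omega> \<Longrightarrow> (k, w) \<noteq> (j, l) \<Longrightarrow> n w \<in> csub \<alpha> k"
        using g unfolding nh parabolic_wreath[OF Diff_subset] free by auto
      have "h = \<one>\<^bsub>cgroup \<beta>\<^esub>" using n(2) borelB unfolding Inl vimage_Inr_types borel_def by blast
      moreover have "n = single l (n l)"
      proof (rule extensionalityI[of _ \<Omega>])
        fix w assume "w \<in> \<Omega>"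
        then show "n w = single l (n l) w" using trivial[OF n(1), of w] n(3)[of _ w] by (auto simp: single_def)
      qed (use n(1) in \<open>auto simp: single_def PiE_iff\<close>)
      moreover have "n l \<in> parabolic \<alpha> (ctypes \<alpha> - {j})" using n(1,3) jl(3) by (auto simp: parabolic_def)
      ultimately show "g \<in> (\<lambda>x. (single l x, \<one>\<^bsub>cgroup \<beta>\<^esub>)) ` parabolic \<alpha> (ctypes \<alpha> - {j})"
        unfolding nh by blast
    next
      fix g assume "g \<in> (\<lambda>x. (single l x, \<one>\<^bsub>cgroup \<beta>\<^esub>)) ` parabolic \<alpha> (ctypes \<alpha> - {j})"
      then obtain x where x: "x \<in> parabolic \<alpha> (ctypes \<alpha> - {j})" "g = (single l x, \<one>\<^bsub>cgroup \<beta>\<^esub>)" by blast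
      have "{k \<in> ctypes \<alpha>. (k, l) \<notin> free_types (ctypes W - {t})} = ctypes \<alpha> - {j}" unfolding free by blast
      then show "g \<in> parabolic W (ctypes W - {t})"
        using single_parabolic[OF Diff_subset jl(3)] x by simp
    qed
    moreover have "inj (\<lambda>x. (single l x, \<one>\<^bsub>cgroup \<beta>\<^esub>))"
      using jl(3) by (auto simp: inj_on_def single_def fun_eq_iff)
    ultimately show ?thesis using cardA[OF jl(2)] by (simp add: card_image inj_on_subset)
  next
    case (Inr i)
    then have i: "i \<in> ctypes \<beta>" using t by auto
    \<comment> \<open>Every orbit is present, so nothing is free and n is trivial by
      \<open>ext\<close>.\<close>
    have free: "free_types (ctypes W - {t}) = {}" using Inr by (auto simp: free_types_def)
    have "parabolic W (ctypes W - {t}) = (\<lambda>h. (\<lambda>w\<in>\<Omega>. \<one>\<^bsub>cgroup \<alpha>\<^esub>, h)) ` parabolic \<beta> (ctypes \<beta> - {i})"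
    proof (intro subset_antisym subsetI)
      fix g assume g: "g \<in> parabolic W (ctypes W - {t})"
      obtain n h where nh: "g = (n, h)" by fastforce
      have "n \<in> \<Omega> \<rightarrow>\<^sub>E carrier (cgroup \<alpha>)" "h \<in> parabolic \<beta> (Inr -` (ctypes W - {t}))"
        "\<And>j w. j \<in> ctypes \<alpha> \<Longrightarrow> w \<in> \<Omega> \<Longrightarrow> n w \<in> csub \<alpha> j"
        using g unfolding nh parabolic_wreath[OF Diff_subset] free by auto
      then show "g \<in> (\<lambda>h. (\<lambda>w\<in>\<Omega>. \<one>\<^bsub>cgroup \<alpha>\<^esub>, h)) ` parabolic \<beta> (ctypes \<beta> - {i})"
        using ext unfolding nh Inr vimage_Inr_types by blast
    next
      fix g assume "g \<in> (\<lambda>h. (\<lambda>w\<in>\<Omega>. \<one>\<^bsub>cgroup \<alpha>\<^esub>, h)) ` parabolic \<beta> (ctypes \<beta> - {i})"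
      then show "g \<in> parabolic W (ctypes W - {t})"
        using top_parabolic[of "ctypes W - {t}"] unfolding Inr vimage_Inr_types by blast
    qed
    then show ?thesis using cardB[OF i] by (simp add: card_image inj_on_def)
  qed
  then have "thin (coset_incidence W)" unfolding W.thin_iff[OF borelW] by blast
  then show ?thesis unfolding thin_coset_geometry_def using borelW by blast
qed

end

theorem theorem4p4:
  fixes \<alpha> :: "('a, 'i) coset_system" and \<beta> :: "('b, 'j) coset_system"
    and \<Omega> :: "'w set" and \<phi> :: "'b \<Rightarrow> 'w \<Rightarrow> 'w"
    and rep :: "('i \<times> 'w) set \<Rightarrow> 'i \<times> 'w"
  assumes "is_coset_system \<alpha>" and "is_coset_system \<beta>"
    and "finite \<Omega>" and "group_action (cgroup \<beta>) \<Omega> \<phi>"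
    and "IPO \<beta> \<Omega> \<phi>"
    and "flag_transitive \<alpha>" and "flag_transitive \<beta>"
    and "admissible_representatives \<alpha> \<beta> \<Omega> \<phi> rep"
  shows "flag_transitive (wreath_system \<alpha> \<beta> \<Omega> \<phi> rep) \<and>
    geometry (coset_incidence (wreath_system \<alpha> \<beta> \<Omega> \<phi> rep)) \<and>
    (residually_connected (coset_incidence \<alpha>) \<and> residually_connected (coset_incidence \<beta>) \<longrightarrow>
       residually_connected (coset_incidence (wreath_system \<alpha> \<beta> \<Omega> \<phi> rep))) \<and>
    (firm (coset_incidence \<alpha>) \<and> firm (coset_incidence \<beta>) \<longrightarrow>
       firm (coset_incidence (wreath_system \<alpha> \<beta> \<Omega> \<phi> rep))) \<and>
    (thin_coset_geometry \<alpha> \<and> thin_coset_geometry \<beta> \<longrightarrow>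
       thin_coset_geometry (wreath_system \<alpha> \<beta> \<Omega> \<phi> rep))"
proof -
  interpret flag_transitive_wreath_system \<alpha> \<beta> \<Omega> \<phi> rep
    by (intro flag_transitive_wreath_system.intro flag_transitive_wreath_system_axioms.intro
        wreath_coset_system.intro wreath_coset_system_axioms.intro coset_incidence_system.intro; fact assms)
  show ?thesis
    using W.flag_transitive W.is_geometry wreath_residually_connected wreath_firm wreath_thin by blast
qed

end
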